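(* There exist a compact set $K\subset\mathbb{C}$, a holomorphic motion $H:\mathbb{D}\times K\to\mathbb{C}$ of $K$ in $\mathbb{C}$, and a $\lambda\in\mathbb{D}$ such that $$R(K)=A(K)\quad\text{but}\quad R(H_\lambda(K))\neq A(H_\lambda(K)),$$ where $H_\lambda=H(\lambda,\cdot)$.
   Context: $\mathbb{D}$ is the open unit disc in $\mathbb{C}$. For a set $E\subset\mathbb{C}$, a holomorphic motion of $E$ in $\mathbb{C}$ (parametrized by $\mathbb{D}$ with base point $0$) is a map $f:\mathbb{D}\times E\to\mathbb{C}$, with $f_\lambda(z)=f(\lambda,z)$, such that: (1) $f(0,z)=z$ for all $z\in E$; (2) for every fixed $\lambda\in\mathbb{D}$, the map $z\mapsto f_\lambda(z)$ is injective on $E$; (3) for every fixed $z\in E$, the map $\lambda\mapsto f(\lambda,z)$ is holomorphic on $\mathbb{D}$. No further regularity in $z$ is assumed. For a compact set $K\subset\mathbb{C}$, $R(K)$ denotes the set of functions on $K$ that are uniform limits on $K$ of rational functions having no poles on $K$, and $A(K)$ denotes the set of complex-valued functions that are continuous on $K$ and holomorphic on the interior $K^\circ$ of $K$. *)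

theory Defs
  imports "HOL-Complex_Analysis.Complex_Analysis" "HOL-Computational_Algebra.Polynomial"
begin

definition holomorphic_motion :: "complex set \<Rightarrow> (complex \<Rightarrow> complex \<Rightarrow> complex) \<Rightarrow> bool" where
  "holomorphic_motion E f \<longleftrightarrow>
     (\<forall>z\<in>E. f 0 z = z) \<and>
     (\<forall>w\<in>ball 0 1. inj_on (f w) E) \<and>
     (\<forall>z\<in>E. (\<lambda>w. f w z) holomorphic_on ball 0 1)"

text \<open>Functions on \<open>K\<close> are represented by total functions of which only the values on \<open>K\<close> matter.
  A rational function has no poles on \<open>K\<close> iff, written in lowest terms, its denominator
  has no zeros on \<open>K\<close>.\<close>

definition rational_without_poles_on :: "complex set \<Rightarrow> (complex \<Rightarrow> complex) \<Rightarrow> bool" where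
  "rational_without_poles_on K r \<longleftrightarrow>
     (\<exists>p q :: complex poly. q \<noteq> 0 \<and> (\<forall>z\<in>K. poly q z \<noteq> 0 \<and> r z = poly p z / poly q z))"

definition R_alg :: "complex set \<Rightarrow> (complex \<Rightarrow> complex) set" where
  "R_alg K = {f. \<exists>r :: nat \<Rightarrow> complex \<Rightarrow> complex.
     (\<forall>n. rational_without_poles_on K (r n)) \<and> uniform_limit K r f sequentially}"

definition A_alg :: "complex set \<Rightarrow> (complex \<Rightarrow> complex) set" where
  "A_alg K = {f. continuous_on K f \<and> f holomorphic_on interior K}"

text \<open>Membership depends only on the values on \<open>K\<close>, so equality of \<open>R_alg K\<close> and \<open>A_alg K\<close>
  is equality of the corresponding sets of functions on \<open>K\<close>.\<close>

lemma R_alg_cong: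
  assumes "\<And>z. z \<in> K \<Longrightarrow> f z = g z"
  shows "f \<in> R_alg K \<longleftrightarrow> g \<in> R_alg K"
proof -
  have "uniform_limit K r f sequentially \<longleftrightarrow> uniform_limit K r g sequentially"
    for r :: "nat \<Rightarrow> complex \<Rightarrow> complex"
    using assms by (intro uniform_limit_cong') auto
  then show ?thesis by (simp add: R_alg_def)
qed

lemma A_alg_cong:
  assumes "\<And>z. z \<in> K \<Longrightarrow> f z = g z"
  shows "f \<in> A_alg K \<longleftrightarrow> g \<in> A_alg K"
proof -
  have "continuous_on K f \<longleftrightarrow> continuous_on K g"
    using assms by (intro continuous_on_cong) auto
  moreover have "f holomorphic_on interior K \<longleftrightarrow> g holomorphic_on interior K"
    using assms interior_subset by (intro holomorphic_cong) auto
  ultimately show ?thesis by (simp add: A_alg_def)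
qed

end

theory Submission
  imports Defs
begin

text \<open>
  Let \<open>E(a)\<close> be the self-similar Cantor set generated by the four maps \<open>z \<mapsto> t + a z\<close> with
  \<open>t = \<plusminus>3/5, \<plusminus>3\<i>/5\<close>. Remove from the closed unit disc a tiny disc at the centre of every cell of the
  construction; these holes accumulate exactly on \<open>E(a)\<close>. The resulting compact set \<open>K(a)\<close> satisfies
  \<open>R(K) = A(K)\<close> when \<open>E(a)\<close> has dimension below one (\<open>4 \<bar>a\<bar> < 1\<close>) and \<open>R(K) \<noteq> A(K)\<close> when the
  dimension exceeds one (\<open>4 \<bar>a\<bar> > 1\<close>), and an explicit self-similar holomorphic motion carries
  \<open>K(6/25)\<close> to \<open>K(a)\<close> for all \<open>a\<close> in a disc around \<open>6/25\<close> that contains points with \<open>4 \<bar>a\<bar> > 1\<close>.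

  For \<open>4 \<bar>a\<bar> < 1\<close>, split off from \<open>f \<in> A(K)\<close> its Laurent parts around the cells of generation \<open>n\<close>.
  Their sum is at most the oscillation of \<open>f\<close> on these cells times
  \<open>\<Sum> \<bar>a\<bar>\<^sup>n / \<bar>z - c\<^sub>w\<bar>\<close>, a sum over the cell centres that is bounded uniformly in \<open>n\<close>, so it can be discarded; what
  remains is continuous on a finitely connected circle domain and holomorphic inside.

  For \<open>4 \<bar>a\<bar> > 1\<close>, the Cauchy transform of the natural measure on \<open>E(a)\<close> is continuous, holomorphic off
  \<open>E(a)\<close>, has integral \<open>2\<pi>\<i>\<close> over the unit circle and integral \<open>0\<close> around every hole. Integration over
  the unit circle minus integration over all the holes' boundaries is a finite measure annihilating
  \<open>R(K)\<close>, so this function is not in \<open>R(K)\<close>.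
\<close>

section \<open>The Cantor cheese\<close>

text \<open>For \<open>cmod a \<le> 3/10\<close> the four discs of radius \<open>cmod a\<close>
  about these points lie in the annulus 3/10 <= |z| <= 9/10 and are at least 1/5 apart. This leaves
  room for a hole at 0 and keeps the unit circle free.\<close>

definition digits :: "complex set" where
  "digits = {Complex (3/5) 0, Complex (- 3/5) 0, Complex 0 (3/5), Complex 0 (- 3/5)}"

definition words :: "nat \<Rightarrow> complex list set" where
  "words n = {w. set w \<subseteq> digits \<and> length w = n}"

text \<open>The cell of a word \<open>w\<close> is the disc with centre \<open>cen a w\<close> and radius \<open>\<bar>a\<bar> ^ length w\<close>, the image of
  the unit disc under the composition of the maps \<open>z \<mapsto> t + a z\<close> along \<open>w\<close>.\<close>

fun cen :: "complex \<Rightarrow> complex list \<Rightarrow> complex" where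
  "cen a [] = 0"
| "cen a (t # w) = t + a * cen a w"

definition rad :: "complex \<Rightarrow> nat \<Rightarrow> real" where
  "rad a n = (cmod a / 8) ^ n / 20"

text \<open>The factor \<open>1/8\<close> in \<open>rad\<close> makes the sum of all radii finite, as there are \<open>4 ^ n\<close> cells of generation \<open>n\<close>.\<close>

definition cheese :: "complex \<Rightarrow> complex set" where
  "cheese a = cball 0 1 - (\<Union>w\<in>lists digits. ball (cen a w) (rad a (length w)))"

section \<open>Digits, words and sums over words\<close>

lemma finite_digits [simp]: "finite digits"
  by (simp add: digits_def)

lemma card_digits: "card digits = 4"
  by (simp add: digits_def card_insert_if)

lemma norm_digit: "t \<in> digits \<Longrightarrow> cmod t = 3/5"
  by (auto simp: digits_def cmod_def real_sqrt_divide)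

lemma digits_dist:
  assumes "s \<in> digits" "t \<in> digits" "s \<noteq> t"
  shows "4/5 \<le> cmod (s - t)"
proof -
  have "(4/5)\<^sup>2 \<le> (cmod (s - t))\<^sup>2"
    unfolding cmod_power2 using assms by (auto simp: digits_def power2_eq_square)
  then show ?thesis
    using norm_ge_zero power2_le_imp_le by blast
qed

text \<open>Two digits closer than 2/5 to \<open>z\<close> would be less than 4/5 apart. In sums
  over \<open>digits\<close> one term is then singled out, while the other three belong to digits at
  a controlled distance.\<close>

lemma nearest_digit:
  obtains t where "t \<in> digits" "\<And>s. s \<in> digits \<Longrightarrow> s \<noteq> t \<Longrightarrow> 2/5 \<le> cmod (z - s)"
proof (cases "\<exists>t\<in>digits. cmod (z - t) < 2/5")
  case True
  then obtain t where t: "t \<in> digits" "cmod (z - t) < 2/5" by blast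
  have "2/5 \<le> cmod (z - s)" if "s \<in> digits" "s \<noteq> t" for s
    using digits_dist[OF that(1) t(1) that(2)] t(2) norm_triangle_ineq4[of "z - t" "z - s"]
    by simp
  then show ?thesis using t that by blast
next
  case False
  then show ?thesis using that[of "Complex (3/5) 0"] by (auto simp: digits_def not_less)
qed

lemma words_0 [simp]: "words 0 = {[]}"
  by (auto simp: words_def)

lemma wordsD:
  assumes "w \<in> words n"
  shows "w \<in> lists digits" "length w = n"
  using assms by (auto simp: words_def)

lemma words_Suc: "words (Suc n) = (\<lambda>(t, w). t # w) ` (digits \<times> words n)"
  by (force simp: words_def length_Suc_conv image_iff)

text \<open>Splitting off the head, as in \<open>words_Suc\<close>, expresses self-similarity;
  splitting off the end replaces each cell by its four children.\<close>

lemma words_Suc_end: "words (Suc n) = (\<lambda>(w, t). w @ [t]) ` (words n \<times> digits)"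
proof -
  have "w \<in> (\<lambda>(w, t). w @ [t]) ` (words n \<times> digits)" if "w \<in> words (Suc n)" for w
  proof -
    have "w \<noteq> []" using that by (auto simp: words_def)
    then have "w = butlast w @ [last w]" by simp
    moreover have "butlast w \<in> words n" "last w \<in> digits"
      using that \<open>w \<noteq> []\<close> by (auto simp: words_def dest: in_set_butlastD)
    ultimately show ?thesis by (metis (no_types, lifting) SigmaI case_prod_conv rev_image_eqI)
  qed
  then show ?thesis by (auto simp: words_def)
qed

lemma finite_words [simp]: "finite (words n)"
  by (simp add: words_def finite_lists_length_eq)

lemma card_words: "card (words n) = 4 ^ n"
  by (simp add: words_def card_lists_length_eq card_digits)

lemma sum_words_Suc: "(\<Sum>w\<in>words (Suc n). f w) = (\<Sum>t\<in>digits. \<Sum>w\<in>words n. f (t # w))"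
  unfolding words_Suc sum.cartesian_product
  by (subst sum.reindex) (auto simp: inj_on_def case_prod_beta)

lemma sum_words_Suc_end: "(\<Sum>w\<in>words (Suc n). f w) = (\<Sum>w\<in>words n. \<Sum>t\<in>digits. f (w @ [t]))"
  unfolding words_Suc_end sum.cartesian_product
  by (subst sum.reindex) (auto simp: inj_on_def case_prod_beta)

section \<open>Position and separation of the cells\<close>

lemma cen_append: "cen a (v @ w) = cen a v + a ^ length v * cen a w"
  by (induction v) (auto simp: algebra_simps)

text \<open>The map z -> t + a z sends the unit disc into the disc of radius 3/5 + 3/10 < 1, so by
  induction every cell stays inside the unit disc.\<close>

lemma cen_bound:
  assumes "cmod a \<le> 3/10" "w \<in> lists digits"
  shows "cmod (cen a w) + cmod a ^ length w \<le> 1"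
  using assms(2)
proof induction
  case (Cons t w)
  have "cmod (cen a (t # w)) + cmod a ^ length (t # w)
      \<le> cmod t + cmod a * (cmod (cen a w) + cmod a ^ length w)"
    using norm_triangle_ineq[of t "a * cen a w"] by (simp add: norm_mult algebra_simps)
  also have "\<dots> \<le> 3/5 + 3/10 * 1"
    using Cons assms norm_digit by (intro add_mono mult_mono) auto
  finally show ?case by simp
qed simp

lemma cen_Cons_bound:
  assumes "cmod a \<le> 3/10" "t \<in> digits" "w \<in> lists digits"
  shows "cmod (cen a (t # w) - t) + cmod a ^ Suc (length w) \<le> cmod a"
proof -
  have "cmod (cen a (t # w) - t) + cmod a ^ Suc (length w)
      = cmod a * (cmod (cen a w) + cmod a ^ length w)"
    by (simp add: norm_mult algebra_simps)
  also have "\<dots> \<le> cmod a * 1"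
    using cen_bound assms by (intro mult_left_mono) auto
  finally show ?thesis by simp
qed

text \<open>The cell of a nonempty word lies within 3/10 of its first digit, whose modulus is 3/5.
  The upper margin keeps cells off the unit circle; the lower one, after rescaling, keeps them off
  the hole at the centre of their parent.\<close>

lemma cen_nonempty_bounds:
  assumes "cmod a \<le> 3/10" "w \<in> lists digits" "w \<noteq> []"
  shows "cmod (cen a w) + cmod a ^ length w \<le> 9/10"
    and "3/10 + cmod a ^ length w \<le> cmod (cen a w)"
proof -
  obtain t v where w: "w = t # v" using assms(3) by (cases w) auto
  have t: "t \<in> digits" "v \<in> lists digits" using assms w by auto
  have *: "cmod (cen a w - t) + cmod a ^ length w \<le> 3/10"
    using cen_Cons_bound[OF assms(1) t] assms(1) w by simp
  show "cmod (cen a w) + cmod a ^ length w \<le> 9/10"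
    using * norm_digit[OF t(1)] norm_triangle_ineq[of t "cen a w - t"] by simp
  show "3/10 + cmod a ^ length w \<le> cmod (cen a w)"
    using * norm_digit[OF t(1)] norm_triangle_ineq2[of t "t - cen a w"]
    by (simp add: norm_minus_commute)
qed

text \<open>The heads are at least 4/5 apart and each cell lies within 3/10 of its head, which
  leaves a gap of 4/5 - 6/10 = 1/5.\<close>

lemma cen_sep_heads:
  assumes "cmod a \<le> 3/10" "s \<in> digits" "t \<in> digits" "s \<noteq> t" "v \<in> lists digits" "w \<in> lists digits"
  shows "1/5 + cmod a ^ Suc (length v) + cmod a ^ Suc (length w) \<le> cmod (cen a (s # v) - cen a (t # w))"
proof -
  have "cmod (s - t) \<le> cmod (cen a (s # v) - cen a (t # w)) + cmod (cen a (s # v) - s) + cmod (cen a (t # w) - t)"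
    using norm_triangle_ineq4[of "cen a (s # v) - cen a (t # w)" "(cen a (s # v) - s) - (cen a (t # w) - t)"]
      norm_triangle_ineq4[of "cen a (s # v) - s" "cen a (t # w) - t"] by simp
  then show ?thesis
    using cen_Cons_bound[OF assms(1,2,5)] cen_Cons_bound[OF assms(1,3,6)] digits_dist[OF assms(2-4)] assms(1)
    by linarith
qed

lemma cen_sep_same:
  assumes "cmod a \<le> 3/10" "a \<noteq> 0" "v \<in> words n" "w \<in> words n" "v \<noteq> w"
  shows "2 * cmod a ^ n < cmod (cen a v - cen a w)"
  using assms(3-5)
proof (induction n arbitrary: v w)
  case (Suc n)
  obtain s v' t w' where vw: "v = s # v'" "w = t # w'" "s \<in> digits" "t \<in> digits" "v' \<in> words n" "w' \<in> words n"
    using Suc.prems by (auto simp: words_Suc)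
  show ?case
  proof (cases "s = t")
    case True
    have "cmod (cen a v - cen a w) = cmod a * cmod (cen a v' - cen a w')"
      by (simp add: vw True flip: norm_mult) (simp add: algebra_simps)
    then show ?thesis using Suc True vw assms(2) by auto
  next
    case False
    then show ?thesis
      using cen_sep_heads[of a s t v' w'] assms(1) vw wordsD[OF vw(5)] wordsD[OF vw(6)] 
      by simp
  qed
qed simp

text \<open>After cancellation of the common prefix either the heads differ or \<open>v\<close> is
  empty; in the second case the cell of \<open>w\<close> stays at least 3/10 away from 0. So a disc
  about the centre of a cell, of one fifth of its radius, is clear of all its subcells as well as of
  other cells of the same or a later generation.\<close>

lemma cen_sep_level:
  assumes "cmod a \<le> 3/10" "a \<noteq> 0" "v \<in> lists digits" "w \<in> lists digits" "v \<noteq> w" "length v \<le> length w"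
  shows "cmod a ^ length v / 5 + cmod a ^ length w < cmod (cen a v - cen a w)"
  using assms(3-6)
proof (induction v arbitrary: w)
  case Nil
  then show ?case using cen_nonempty_bounds(2)[OF assms(1), of w] by simp
next
  case (Cons s v' w)
  obtain t w' where w: "w = t # w'" "t \<in> digits" "w' \<in> lists digits" 
    using Cons.prems by (cases w) auto
  have s: "s \<in> digits" "v' \<in> lists digits" using Cons.hyps by auto
  show ?case
  proof (cases "s = t")
    case True
    have "cmod (cen a (s # v') - cen a w) = cmod a * cmod (cen a v' - cen a w')"
      by (simp add: w True flip: norm_mult) (simp add: algebra_simps)
    moreover have "cmod a ^ length v' / 5 + cmod a ^ length w' < cmod (cen a v' - cen a w')"
      using Cons.IH[of w'] Cons.prems w True by auto
    then have "cmod a * (cmod a ^ length v' / 5 + cmod a ^ length w') < cmod a * cmod (cen a v' - cen a w')"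
      using assms(2) by simp
    ultimately show ?thesis using w by (simp add: algebra_simps)
  next
    case False
    have "cmod a ^ length (s # v') / 5 \<le> 1/5 * cmod a ^ length (s # v')" by simp
    moreover have "cmod a ^ length (s # v') > 0" using assms by simp
    ultimately show ?thesis
      using cen_sep_heads[OF assms(1) s(1) w(2) False s(2) w(3)] w
      by (simp del: power_Suc)
  qed
qed

section \<open>Hole radii and sums over one generation\<close>

lemma rad_pos: "a \<noteq> 0 \<Longrightarrow> 0 < rad a n"
  by (simp add: rad_def)

lemma rad_le: "rad a n \<le> cmod a ^ n / 20"
proof -
  have "(cmod a / 8) ^ n \<le> cmod a ^ n" by (intro power_mono) auto
  then show ?thesis by (simp add: rad_def)
qed

lemma rad_disjoint:
  assumes "cmod a \<le> 3/10" "a \<noteq> 0" "v \<in> lists digits" "w \<in> lists digits" "v \<noteq> w"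
  shows "rad a (length v) + rad a (length w) < cmod (cen a v - cen a w)"
proof -
  have *: "rad a (length v) + rad a (length w) < cmod (cen a v - cen a w)"
    if "v \<in> lists digits" "w \<in> lists digits" "v \<noteq> w" "length v \<le> length w" for v w
    using cen_sep_level[OF assms(1,2) that] rad_le[of a "length v"] rad_le[of a "length w"]
      zero_le_power[OF norm_ge_zero, of a "length v"] zero_le_power[OF norm_ge_zero, of a "length w"]
    by linarith
  show ?thesis
  proof (cases "length v \<le> length w")
    case True
    then show ?thesis using *[OF assms(3-5)] by simp
  next
    case False
    then show ?thesis using *[OF assms(4,3)] assms(5) by (simp add: norm_minus_commute)
  qed
qed

text \<open>At each generation only one of the four subcells can be close to \<open>z\<close>; the other three
  contribute a term of the geometric series with ratio \<open>4 \<bar>a\<bar> ^ p\<close>.\<close>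

lemma sum_words_bound:
  assumes "cmod a \<le> 3/10" "a \<noteq> 0" "4 * cmod a ^ p < 1"
  shows "(\<Sum>w\<in>words n. (1 / max 1 (cmod (z - cen a w) / cmod a ^ n)) ^ p) \<le> 1 + 10 ^ p / (1 - 4 * cmod a ^ p)"
proof -
  define M where "M = 4 * cmod a ^ p"
  have M: "0 \<le> M" "M < 1" using assms by (auto simp: M_def)
  \<comment> \<open>The base is the minimum of 1 and |a|^n / |z - c|, with c the cell centre. Power
    1 is the decay of a Laurent part; power 2 is the decay of a difference of Cauchy transforms of
    equal total mass.\<close>
  define q where "q n z w = (1 / max 1 (cmod (z - cen a w) / cmod a ^ n)) ^ p" for n z w
  have q01: "0 \<le> q n z w" "q n z w \<le> 1" for n z w 
    unfolding q_def by (auto intro!: power_le_one)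
  have step: "q (Suc n) z (t # w) = q n ((z - t) / a) w" for n z t w
  proof -
    have "z - cen a (t # w) = a * ((z - t) / a - cen a w)"
      using assms(2) by (simp add: field_simps)
    then have "cmod (z - cen a (t # w)) / cmod a ^ Suc n = cmod ((z - t) / a - cen a w) / cmod a ^ n"
      using assms(2) by (simp add: norm_mult del: cen.simps)
    then show ?thesis by (simp only: q_def)
  qed
  \<comment> \<open>The centre of the cell is within 3/10 of \<open>t\<close>, hence at least 2/5 -
    3/10 = 1/10 away from \<open>z\<close>; this is the origin of the factor 10.\<close>
  have far: "q (Suc n) z (t # w) \<le> (10 * cmod a ^ Suc n) ^ p" 
    if "2/5 \<le> cmod (z - t)" "t \<in> digits" "w \<in> words n" for n z t w
  proof -
    have "cmod (cen a (t # w) - t) \<le> 3/10"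
      using cen_Cons_bound[OF assms(1) that(2) wordsD(1)[OF that(3)]] assms(1)
        zero_le_power[OF norm_ge_zero, of a "Suc (length w)"]
      by linarith
    then have "1/10 \<le> cmod (z - cen a (t # w))"
      using that(1) norm_triangle_ineq[of "z - cen a (t # w)" "cen a (t # w) - t"] by simp
    then have "1 / (10 * cmod a ^ Suc n) \<le> cmod (z - cen a (t # w)) / cmod a ^ Suc n"
      using assms(2) by (simp add: divide_simps)
    then have "1 / (10 * cmod a ^ Suc n) \<le> max 1 (cmod (z - cen a (t # w)) / cmod a ^ Suc n)"
      by linarith
    then have "1 / max 1 (cmod (z - cen a (t # w)) / cmod a ^ Suc n) \<le> 1 / (1 / (10 * cmod a ^ Suc n))"
      using assms(2) by (intro divide_left_mono) auto
    then show ?thesis unfolding q_def by (intro power_mono) (auto simp del: power_Suc)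
  qed
  \<comment> \<open>The claim is proved for all \<open>z\<close> at once, because the cells below
    the nearest digit see the rescaled point \<open>(z - t) / a\<close>.\<close>
  have "(\<Sum>w\<in>words n. q n z w) \<le> 1 + 10 ^ p * (\<Sum>k<n. M ^ Suc k)" for n z
  proof (induction n arbitrary: z)
    case 0
    show ?case using q01 by simp
  next
    case (Suc n)
    obtain t where t: "t \<in> digits" "\<And>s. s \<in> digits \<Longrightarrow> s \<noteq> t \<Longrightarrow> 2/5 \<le> cmod (z - s)"
      using nearest_digit by blast
    have "(\<Sum>w\<in>words (Suc n). q (Suc n) z w) = (\<Sum>w\<in>words n. q (Suc n) z (t # w)) 
        + (\<Sum>s\<in>digits - {t}. \<Sum>w\<in>words n. q (Suc n) z (s # w))"
      unfolding sum_words_Suc using t by (simp add: sum.remove)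
    also have "(\<Sum>w\<in>words n. q (Suc n) z (t # w)) \<le> 1 + 10 ^ p * (\<Sum>k<n. M ^ Suc k)"
      using Suc[of "(z - t) / a"] by (simp add: step)
    also have "(\<Sum>s\<in>digits - {t}. \<Sum>w\<in>words n. q (Suc n) z (s # w)) 
        \<le> (\<Sum>s\<in>digits - {t}. \<Sum>w\<in>words n. (10 * cmod a ^ Suc n) ^ p)"
      using t far by (intro sum_mono) (auto simp del: power_Suc)
    also have "\<dots> \<le> (\<Sum>s\<in>digits. \<Sum>w\<in>words n. (10 * cmod a ^ Suc n) ^ p)"
      by (intro sum_mono2) (auto intro: sum_nonneg)
    also have "\<dots> = 10 ^ p * M ^ Suc n"
    proof -
      have "M ^ Suc n = 4 ^ Suc n * (cmod a ^ Suc n) ^ p"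
        unfolding M_def power_mult_distrib by (metis power_commutes power_mult mult.commute)
      then show ?thesis by (simp add: card_words card_digits power_mult_distrib)
    qed
    finally show ?case by (simp add: algebra_simps)
  qed
  moreover have "(\<Sum>k<n. M ^ Suc k) \<le> 1 / (1 - M)"
  proof -
    have "(\<Sum>k<n. M ^ Suc k) \<le> (\<Sum>k<n. M ^ k)"
      using M by (intro sum_mono) (simp add: mult_left_le_one_le)
    also have "\<dots> \<le> (\<Sum>k. M ^ k)"
      using M by (intro sum_le_suminf) auto
    also have "\<dots> = 1 / (1 - M)" using M by (intro suminf_geometric) auto
    finally show ?thesis .
  qed
  then have "10 ^ p * (\<Sum>k<n. M ^ Suc k) \<le> 10 ^ p * (1 / (1 - M))"
    by (intro mult_left_mono) auto
  ultimately have "(\<Sum>w\<in>words n. q n z w) \<le> 1 + 10 ^ p * (1 / (1 - M))"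
    by (meson add_left_mono order_trans)
  then show ?thesis
    by (simp add: q_def M_def)
qed

section \<open>A self-similar holomorphic motion\<close>

text \<open>A cutoff that is 1 up to the cell radius 6/25 and 0 from 2/5 on, so that at most one
  digit is active at a time. Its slope 25/4 is the source of the Lipschitz constants that
  follow.\<close>

definition chi :: "real \<Rightarrow> real" where
  "chi r = max 0 (min 1 ((2/5 - r) / (4/25)))"

definition bump :: "complex \<Rightarrow> complex" where
  "bump u = of_real (chi (cmod u)) * u"

text \<open>\<open>layer k\<close> displaces the cells of generation \<open>k + 1\<close>, measured
  in units of their parent cell; \<open>motion\<close> restores the actual size by the factor
  \<open>ratio l ^ k\<close>.\<close>

fun layer :: "nat \<Rightarrow> complex \<Rightarrow> complex" where
  "layer 0 z = (\<Sum>t\<in>digits. bump (z - t))"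
| "layer (Suc k) z = (\<Sum>t\<in>digits. layer k ((z - t) / (6/25)))"

text \<open>The divisor 16 exceeds the Lipschitz constant 14 of \<open>layer 0\<close>, so that one
  step is a perturbation of the identity, while the modulus still approaches 51/200 > 1/4 as
  \<open>l\<close> tends to 1.\<close>

definition ratio :: "complex \<Rightarrow> complex" where
  "ratio l = 6/25 * (1 + l / 16)"

text \<open>The displacement \<open>D z = motion l z - z\<close> solves
  \<open>D z = l/16 * layer 0 z + ratio l * (\<Sum>t\<in>digits. D ((z - t) / (6/25)))\<close>: the summand \<open>layer 0\<close> rescales the
  first-generation cells about their centres, and the sum repeats this inside each cell. No case
  distinction is needed because every layer vanishes outside the unit disc.\<close>

definition motion :: "complex \<Rightarrow> complex \<Rightarrow> complex" where
  "motion l z = z + l / 16 * (\<Sum>k. ratio l ^ k * layer k z)"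

section \<open>Cutoff, bump and layers\<close>

lemma sum_digits_single:
  assumes "t \<in> digits" "\<And>s. s \<in> digits \<Longrightarrow> s \<noteq> t \<Longrightarrow> f s = 0"
  shows "(\<Sum>s\<in>digits. f s) = (f t :: complex)"
  using assms by (subst sum.remove[of _ t]) (auto intro: sum.neutral)

lemma chi_01: "0 \<le> chi r" "chi r \<le> 1"
  by (auto simp: chi_def)

lemma chi_lipschitz: "\<bar>chi r - chi s\<bar> \<le> 25/4 * \<bar>r - s\<bar>"
proof -
  have "chi r = (if r \<le> 6/25 then 1 else if r \<le> 2/5 then 5/2 - 25/4 * r else 0)" for r
    by (auto simp: chi_def max_def min_def field_simps)
  then show ?thesis by (simp add: abs_if)
qed

lemma bump_zero: "2/5 \<le> cmod u \<Longrightarrow> bump u = 0"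
  by (simp add: bump_def chi_def)

lemma bump_id: "cmod u \<le> 6/25 \<Longrightarrow> bump u = u"
  by (simp add: bump_def chi_def)

lemma bump_bound: "cmod (bump u) \<le> 2/5"
proof (cases "2/5 \<le> cmod u")
  case False
  have "cmod (bump u) \<le> 1 * cmod u"
    unfolding bump_def norm_mult using chi_01[of "cmod u"] by (intro mult_right_mono) auto
  then show ?thesis using False by simp
qed (simp add: bump_zero)

text \<open>A product rule: the factor \<open>u\<close> contributes 1, and the slope 25/4 of
  \<open>chi\<close> is multiplied by the modulus of a point in the support, at most 2/5. The sum is
  7/2.\<close>

lemma bump_lipschitz: "cmod (bump u - bump v) \<le> 7/2 * cmod (u - v)"
proof -
  have *: "cmod (bump u - bump v) \<le> 7/2 * cmod (u - v)" if "cmod v \<le> 2/5" for u v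
  proof -
    have "bump u - bump v = of_real (chi (cmod u)) * (u - v) + of_real (chi (cmod u) - chi (cmod v)) * v"
      by (simp add: bump_def algebra_simps)
    also have "cmod \<dots> \<le> chi (cmod u) * cmod (u - v) + \<bar>chi (cmod u) - chi (cmod v)\<bar> * cmod v"
      by (rule order_trans[OF norm_triangle_ineq]) (simp add: norm_mult chi_01 del: of_real_diff)
    also have "\<dots> \<le> 1 * cmod (u - v) + (25/4 * cmod (u - v)) * (2/5)"
    proof (intro add_mono mult_mono that)
      show "\<bar>chi (cmod u) - chi (cmod v)\<bar> \<le> 25/4 * cmod (u - v)"
        by (rule order_trans[OF chi_lipschitz]) (use norm_triangle_ineq3[of u v] in simp)
    qed (use chi_01 in auto)
    finally show ?thesis by simp
  qed
  consider "cmod v \<le> 2/5" | "cmod u \<le> 2/5" | "2/5 \<le> cmod u" "2/5 \<le> cmod v" by linarith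
  then show ?thesis
  proof cases
    case 1 then show ?thesis using * by blast
  next
    case 2 then show ?thesis using *[of u v] by (metis norm_minus_commute)
  next
    case 3 then show ?thesis by (simp add: bump_zero)
  qed
qed

lemma continuous_on_bump: "continuous_on UNIV bump"
proof -
  have "(7/2)-lipschitz_on UNIV bump"
    by (rule lipschitz_onI) (use bump_lipschitz in \<open>auto simp: dist_norm\<close>)
  then show ?thesis by (rule lipschitz_on_continuous_on)
qed

lemma layer_0_lipschitz: "cmod (layer 0 u - layer 0 v) \<le> 14 * cmod (u - v)"
proof -
  have "cmod (layer 0 u - layer 0 v) \<le> (\<Sum>t\<in>digits. cmod (bump (u - t) - bump (v - t)))"
    unfolding layer.simps sum_subtractf[symmetric] by (rule norm_sum)
  also have "\<dots> \<le> (\<Sum>t\<in>digits. 7/2 * cmod (u - v))"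
  proof (rule sum_mono)
    show "cmod (bump (u - t) - bump (v - t)) \<le> 7/2 * cmod (u - v)" for t
      using bump_lipschitz[of "u - t" "v - t"] by simp
  qed
  finally show ?thesis by (simp add: card_digits)
qed

lemma digit_dist_outside: "1 \<le> cmod z \<Longrightarrow> t \<in> digits \<Longrightarrow> 2/5 \<le> cmod (z - t)"
  using norm_triangle_ineq2[of z t] norm_digit[of t] by simp

lemma norm_rescale: "cmod ((z - t) / (6/25)) = 25/6 * cmod (z - t)"
  by (subst norm_divide) simp

text \<open>A point outside the unit disc is at least 2/5 from every digit, and 25/6 * 2/5 = 5/3
  shows that all its rescaled copies are again outside.\<close>

lemma layer_zero: "1 \<le> cmod z \<Longrightarrow> layer k z = 0"
proof (induction k arbitrary: z)
  case 0
  then show ?case using digit_dist_outside[of z] by (auto intro!: sum.neutral bump_zero)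
next
  case (Suc k)
  have "1 \<le> cmod ((z - t) / (6/25))" if "t \<in> digits" for t
    using digit_dist_outside[OF Suc.prems that] unfolding norm_rescale by simp
  then show ?case using Suc.IH by (auto intro!: sum.neutral)
qed

lemma layer_near:
  assumes "t \<in> digits" "\<And>s. s \<in> digits \<Longrightarrow> s \<noteq> t \<Longrightarrow> 2/5 \<le> cmod (z - s)"
  shows "layer 0 z = bump (z - t)" "layer (Suc k) z = layer k ((z - t) / (6/25))"
proof -
  show "layer 0 z = bump (z - t)"
    unfolding layer.simps by (rule sum_digits_single[OF assms(1)]) (use assms bump_zero in auto)
  have "1 \<le> cmod ((z - s) / (6/25))" if "s \<in> digits" "s \<noteq> t" for s
    using assms(2)[OF that] unfolding norm_rescale by simp
  then show "layer (Suc k) z = layer k ((z - t) / (6/25))"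
    unfolding layer.simps by (intro sum_digits_single[OF assms(1)] layer_zero) auto
qed

lemma layer_bound: "cmod (layer k z) \<le> 2/5"
proof (induction k arbitrary: z)
  case 0
  obtain t where "t \<in> digits" "\<And>s. s \<in> digits \<Longrightarrow> s \<noteq> t \<Longrightarrow> 2/5 \<le> cmod (z - s)"
    using nearest_digit by blast
  then show ?case using layer_near(1)[of t z] bump_bound by simp
next
  case (Suc k)
  obtain t where "t \<in> digits" "\<And>s. s \<in> digits \<Longrightarrow> s \<noteq> t \<Longrightarrow> 2/5 \<le> cmod (z - s)"
    using nearest_digit by blast
  then show ?case using layer_near(2)[of t z] Suc by metis
qed

lemma continuous_on_layer: "continuous_on UNIV (layer k)"
proof (induction k)
  case 0
  have "continuous_on UNIV (\<lambda>z. bump (z - t))" for t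
    by (rule continuous_on_compose2[OF continuous_on_bump]) (auto intro!: continuous_intros)
  then show ?case unfolding layer.simps by (intro continuous_on_sum) auto
next
  case (Suc k)
  have "continuous_on UNIV (\<lambda>z. layer k ((z - t) / (6/25)))" for t
    by (rule continuous_on_compose2[OF Suc]) (auto intro!: continuous_intros)
  then show ?case unfolding layer.simps by (intro continuous_on_sum) auto
qed

section \<open>The displacement series for a fixed parameter\<close>

context
  fixes l :: complex
  assumes l: "cmod l < 1"
begin

lemma norm_scale: "15/16 < cmod (1 + l/16)" "cmod (1 + l/16) < 17/16"
  using l norm_triangle_ineq2[of 1 "- (l/16)"] norm_triangle_ineq[of 1 "l/16"]
  by (auto simp: norm_divide)

lemma norm_ratio: "cmod (ratio l) = 6/25 * cmod (1 + l/16)"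
  unfolding ratio_def norm_mult by simp

lemma ratio_bound: "cmod (ratio l) \<le> 3/10"
  using norm_scale by (simp add: norm_ratio)

lemma ratio_nz: "ratio l \<noteq> 0"
  using norm_scale norm_ratio by auto

lemma norm_term: "cmod (ratio l ^ k * layer k z) \<le> 2/5 * (3/10) ^ k"
proof -
  have "cmod (ratio l ^ k * layer k z) \<le> (3/10) ^ k * (2/5)"
    unfolding norm_mult norm_power using ratio_bound layer_bound
    by (intro mult_mono power_mono) auto
  then show ?thesis by simp
qed

lemma summable_term: "summable (\<lambda>k. ratio l ^ k * layer k z)"
  by (rule summable_comparison_test'[of "\<lambda>k. 2/5 * (3/10) ^ k"]) (use norm_term in auto)

lemma continuous_on_motion: "continuous_on UNIV (motion l)"
proof -
  have "uniform_limit UNIV (\<lambda>n z. \<Sum>k<n. ratio l ^ k * layer k z) (\<lambda>z. \<Sum>k. ratio l ^ k * layer k z) sequentially"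
    by (rule Weierstrass_m_test[of _ _ "\<lambda>k. 2/5 * (3/10) ^ k"]) (use norm_term in auto)
  then have "continuous_on UNIV (\<lambda>z. \<Sum>k. ratio l ^ k * layer k z)"
    by (rule uniform_limit_theorem[rotated])
       (auto intro!: continuous_intros always_eventually continuous_on_layer)
  then show ?thesis unfolding motion_def by (intro continuous_intros)
qed

text \<open>On a first-generation cell \<open>layer 0\<close> is the offset from \<open>t\<close>,
  and each higher layer is the preceding layer at the rescaled point. Splitting off the head of the
  series thus reproduces the motion at scale \<open>ratio l\<close>.\<close>

lemma motion_digit:
  assumes "t \<in> digits" "cmod z \<le> 1"
  shows "motion l (t + 6/25 * z) = t + ratio l * motion l z"
proof -
  define z' where "z' = t + 6/25 * z"
  have far: "2/5 \<le> cmod (z' - s)" if "s \<in> digits" "s \<noteq> t" for s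
  proof -
    have "cmod (s - t) \<le> cmod (z' - s) + cmod (6/25 * z)"
      using norm_triangle_ineq4[of "6/25 * z" "z' - s"] by (simp add: z'_def)
    then show ?thesis using digits_dist[OF that(1) assms(1) that(2)] assms(2) by (simp add: norm_mult)
  qed
  have near: "layer 0 z' = 6/25 * z" "layer (Suc k) z' = layer k z" for k
    using layer_near[OF assms(1), of z'] far assms(2) by (auto simp: z'_def bump_id norm_mult)
  have "(\<Sum>k. ratio l ^ k * layer k z') = 6/25 * z + (\<Sum>k. ratio l ^ Suc k * layer (Suc k) z')"
    using suminf_split_head[OF summable_term, of z'] near(1) by simp
  also have "(\<Sum>k. ratio l ^ Suc k * layer (Suc k) z') = ratio l * (\<Sum>k. ratio l ^ k * layer k z)"
    unfolding near using suminf_mult[OF summable_term, of "ratio l" z] by (simp add: mult.assoc)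
  finally have eq: "(\<Sum>k. ratio l ^ k * layer k z') = 6/25 * z + ratio l * (\<Sum>k. ratio l ^ k * layer k z)" .
  have "t + 6/25 * z + l / 16 * (6/25 * z + ratio l * S) = t + ratio l * (z + l / 16 * S)" for S
    by (simp add: ratio_def field_simps)
  then show ?thesis
    unfolding motion_def z'_def[symmetric] eq by (simp only: z'_def)
qed

text \<open>All layers but the first are supported in the first-generation cells, so only one step
  of the recursion is visible here.\<close>

lemma motion_off_cells:
  assumes "\<And>t. t \<in> digits \<Longrightarrow> 6/25 < cmod (z - t)"
  shows "motion l z = z + l / 16 * layer 0 z"
proof -
  have "layer (Suc k) z = 0" for k
    unfolding layer.simps using assms
    by (intro sum.neutral ballI layer_zero) (use norm_rescale in force)
  then have "(\<Sum>k. ratio l ^ k * layer k z) = layer 0 z"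
    using suminf_split_head[OF summable_term, of z] by simp
  then show ?thesis by (simp add: motion_def)
qed

text \<open>The displacement is supported within 2/5 of the digits, hence at least 3/5 - 2/5 = 1/5
  away from 0. This is why the central hole is fixed and every other hole moves by an affine
  map.\<close>

lemma motion_small: "cmod z \<le> 1/5 \<Longrightarrow> motion l z = z"
proof -
  assume z: "cmod z \<le> 1/5"
  have "2/5 \<le> cmod (z - t)" if "t \<in> digits" for t
    using norm_triangle_ineq2[of t z] norm_digit[OF that] z by (simp add: norm_minus_commute)
  then show ?thesis
    by (subst motion_off_cells) (force intro!: sum.neutral bump_zero)+
qed

section \<open>The one-step map as a perturbation of the identity\<close>

lemma base_inj: "inj (\<lambda>z. z + l / 16 * layer 0 z)"
proof (rule injI)
  fix u v assume "u + l / 16 * layer 0 u = v + l / 16 * layer 0 v"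
  then have "u - v = - (l / 16 * (layer 0 u - layer 0 v))" by (simp add: algebra_simps)
  then have "cmod (u - v) = cmod l / 16 * cmod (layer 0 u - layer 0 v)"
    by (metis norm_divide norm_minus_cancel norm_mult norm_numeral)
  \<comment> \<open>As 14/16 < 1, the distance must vanish; the same constant yields the contraction
    in \<open>base_surj\<close>.\<close>
  also have "\<dots> \<le> 1 / 16 * (14 * cmod (u - v))"
    using l layer_0_lipschitz by (intro mult_mono) auto
  finally show "u = v" by simp
qed

lemma base_surj: "\<exists>z. z + l / 16 * layer 0 z = y"
proof -
  have "\<exists>!z\<in>UNIV. y - l / 16 * layer 0 z = z"
  proof (rule Banach_fix[of UNIV "14/16"])
    show "dist (y - l / 16 * layer 0 u) (y - l / 16 * layer 0 v) \<le> 14 / 16 * dist u v" for u v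
    proof -
      have "dist (y - l / 16 * layer 0 u) (y - l / 16 * layer 0 v) = cmod l / 16 * cmod (layer 0 u - layer 0 v)"
      proof -
        have "y - l / 16 * layer 0 u - (y - l / 16 * layer 0 v) = - (l / 16 * (layer 0 u - layer 0 v))"
          by (simp add: algebra_simps)
        then show ?thesis unfolding dist_norm by (metis norm_divide norm_minus_cancel norm_mult norm_numeral)
      qed
      also have "\<dots> \<le> 1 / 16 * (14 * cmod (u - v))"
        using l layer_0_lipschitz by (intro mult_mono) auto
      finally show ?thesis by (simp add: dist_norm)
    qed
  qed (auto simp: complete_UNIV)
  then obtain z where "y - l / 16 * layer 0 z = z" by blast
  then show ?thesis by (metis diff_add_cancel)
qed

lemma base_digit:
  assumes "t \<in> digits" "cmod u \<le> 6/25"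
  shows "layer 0 (t + u) = u"
proof -
  have "2/5 \<le> cmod (t + u - s)" if "s \<in> digits" "s \<noteq> t" for s
    using digits_dist[OF that(1) assms(1) that(2)] assms(2)
      norm_triangle_ineq4[of u "t + u - s"] by simp
  then show ?thesis using layer_near(1)[OF assms(1), of "t + u"] assms(2) by (simp add: bump_id)
qed

text \<open>On the disc of radius 6/25 about \<open>t\<close> the one-step map is the dilation by
  \<open>1 + l / 16\<close> about \<open>t\<close>, onto the disc of radius
  \<open>cmod (ratio l)\<close>. By injectivity the points of that disc have no further
  preimage.\<close>

lemma base_cell:
  assumes "t \<in> digits" "cmod (z + l / 16 * layer 0 z - t) \<le> cmod (ratio l)"
  shows "cmod (z - t) \<le> 6/25"
proof -
  define u where "u = (z + l / 16 * layer 0 z - t) / (1 + l / 16)"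
  have nz: "1 + l / 16 \<noteq> 0" using norm_scale by auto
  have "cmod u \<le> 6/25"
    unfolding u_def norm_divide using assms(2) norm_scale nz by (subst pos_divide_le_eq) (auto simp: norm_ratio)
  moreover have "u * (1 + l / 16) = z + l / 16 * layer 0 z - t"
    unfolding u_def using nz by simp
  then have "t + u + l / 16 * layer 0 (t + u) = z + l / 16 * layer 0 z"
    unfolding base_digit[OF assms(1) \<open>cmod u \<le> 6/25\<close>] by (simp add: algebra_simps)
  then have "t + u = z" using base_inj by (auto dest: injD)
  ultimately show ?thesis by auto
qed

text \<open>The one-step map is the identity outside the unit disc, so by injectivity no inner point
  can land there.\<close>

lemma base_disc:
  assumes "cmod z \<le> 1"
  shows "cmod (z + l / 16 * layer 0 z) \<le> 1"
proof (rule ccontr)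
  define y where "y = z + l / 16 * layer 0 z"
  assume "\<not> cmod (z + l / 16 * layer 0 z) \<le> 1"
  then have y: "1 < cmod y" by (simp add: y_def)
  then have "y + l / 16 * layer 0 y = z + l / 16 * layer 0 z"
    using layer_zero[of y 0] by (simp add: y_def del: layer.simps)
  then have "y = z" using base_inj by (auto dest: injD)
  then show False using y assms by simp
qed

text \<open>A crude geometric series bound, 1 + (4/7)/16 < 11/10. It starts
  \<open>motion_disc\<close>, where the factor \<open>ratio l\<close> on the cells improves it to
  3/5 + 33/100 < 1.\<close>

lemma motion_disc_weak:
  assumes "cmod z \<le> 1"
  shows "cmod (motion l z) \<le> 11/10"
proof -
  have "cmod (\<Sum>k. ratio l ^ k * layer k z) \<le> (\<Sum>k. 2/5 * (3/10) ^ k)"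
    by (rule norm_suminf_le[OF norm_term]) auto
  also have "\<dots> = 4/7" by (subst suminf_mult) (auto simp: suminf_geometric)
  finally have "cmod (l / 16 * (\<Sum>k. ratio l ^ k * layer k z)) \<le> 1/16 * (4/7)"
    unfolding norm_mult using l by (intro mult_mono) (auto simp: norm_divide)
  then show ?thesis
    using assms norm_triangle_ineq[of z "l / 16 * (\<Sum>k. ratio l ^ k * layer k z)"]
    by (simp add: motion_def)
qed

section \<open>Injectivity and surjectivity on the unit disc\<close>

lemma cell_cases:
  assumes "cmod z \<le> 1"
  obtains t u where "t \<in> digits" "cmod u \<le> 1" "z = t + 6/25 * u"
  | "\<And>t. t \<in> digits \<Longrightarrow> 6/25 < cmod (z - t)"
proof (cases "\<exists>t\<in>digits. cmod (z - t) \<le> 6/25")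
  case True
  then obtain t where t: "t \<in> digits" "cmod (z - t) \<le> 6/25" by blast
  show ?thesis
  proof (rule that(1)[of t "(z - t) / (6/25)"])
    show "cmod ((z - t) / (6/25)) \<le> 1" unfolding norm_rescale using t by simp
    show "z = t + 6/25 * ((z - t) / (6/25))" by (simp add: field_simps)
  qed (rule t)
next
  case False
  then show ?thesis using that(2) by force
qed

lemma motion_disc:
  assumes "cmod z \<le> 1"
  shows "cmod (motion l z) \<le> 1"
  using assms
proof (cases rule: cell_cases)
  case (1 t u)
  have "cmod (motion l z) \<le> cmod t + cmod (ratio l) * cmod (motion l u)"
    unfolding 1(3) motion_digit[OF 1(1,2)] by (metis norm_mult norm_triangle_ineq)
  also have "\<dots> \<le> 3/5 + 3/10 * (11/10)"
    using norm_digit[OF 1(1)] ratio_bound motion_disc_weak[OF 1(2)] by (intro add_mono mult_mono) auto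
  finally show ?thesis by simp
next
  case 2
  then show ?thesis using base_disc[OF assms] motion_off_cells by metis
qed

text \<open>Equal images force both points into the same first-generation cell or both outside all
  of them. In the first case the rescaled points again have equal images, which gains a factor 6/25;
  in the second the one-step map is injective.\<close>

lemma motion_separation:
  assumes "cmod u \<le> 1" "cmod v \<le> 1" "motion l u = motion l v"
  shows "cmod (u - v) \<le> 2 * (6/25) ^ n"
  using assms
proof (induction n arbitrary: u v)
  case (0 u v)
  have "cmod (u - v) \<le> 1 + 1" using norm_triangle_ineq4[of u v] 0(1,2) by linarith
  then show ?case by simp
next
  case (Suc n u v)
  have cell: "cmod (motion l (t + 6/25 * u) - t) \<le> cmod (ratio l)" if "t \<in> digits" "cmod u \<le> 1" for t u
    using motion_digit[OF that] motion_disc[OF that(2)] by (simp add: norm_mult mult_left_le)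
  \<comment> \<open>By \<open>base_cell\<close>, a point off the cells is never mapped into the disc
    that contains the image of a cell.\<close>
  have mixed: "\<not> (motion l (t + 6/25 * u) = motion l v)"
    if "t \<in> digits" "cmod u \<le> 1" "\<And>t. t \<in> digits \<Longrightarrow> 6/25 < cmod (v - t)" for t u v
  proof
    assume "motion l (t + 6/25 * u) = motion l v"
    then have "cmod (v - t) \<le> 6/25"
      using cell[OF that(1,2)] base_cell[OF that(1), of v] motion_off_cells[OF that(3)] by simp
    then show False using that(3)[OF that(1)] by simp
  qed
  from Suc.prems(1) show ?case
  proof (cases rule: cell_cases)
    case u: (1 s u')
    from Suc.prems(2) show ?thesis
    proof (cases rule: cell_cases)
      case v: (1 t v')
      have "s = t"
      proof (rule ccontr)
        assume "s \<noteq> t"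
        then have "4/5 \<le> cmod (s - t)" using digits_dist u v by blast
        moreover have "cmod (s - t) \<le> cmod (ratio l) + cmod (ratio l)"
          using cell[OF u(1,2)] cell[OF v(1,2)] Suc.prems(3) u(3) v(3)
            norm_triangle_ineq4[of "motion l u - t" "motion l u - s"] by (simp add: norm_minus_commute)
        ultimately show False using ratio_bound by simp
      qed
      have "motion l u = t + ratio l * motion l u'"
        using motion_digit[OF u(1,2)] u(3) \<open>s = t\<close> by (simp only:)
      moreover have "motion l v = t + ratio l * motion l v'"
        using motion_digit[OF v(1,2)] v(3) by (simp only:)
      ultimately have "motion l u' = motion l v'"
        using Suc.prems(3) ratio_nz by simp
      then have "cmod (u' - v') \<le> 2 * (6/25) ^ n" using Suc.IH u(2) v(2) by blast
      moreover have "u - v = 6/25 * (u' - v')" using u v \<open>s = t\<close> by (simp add: algebra_simps)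
      then have "cmod (u - v) = 6/25 * cmod (u' - v')" by (simp only: norm_mult) simp
      ultimately show ?thesis by simp
    next
      case 2
      then show ?thesis using mixed[OF u(1,2), of v] u(3) Suc.prems(3) by simp
    qed
  next
    case u: 2
    from Suc.prems(2) show ?thesis
    proof (cases rule: cell_cases)
      case v: (1 t v')
      then show ?thesis using mixed[OF v(1,2), of u] u Suc.prems(3) by simp
    next
      case 2
      then have "u + l / 16 * layer 0 u = v + l / 16 * layer 0 v"
        using motion_off_cells[of u] motion_off_cells[of v] u Suc.prems(3) by simp
      then have "u = v" using base_inj by (auto dest: injD)
      then show ?thesis by simp
    qed
  qed
qed

lemma motion_inj: "inj_on (motion l) (cball 0 1)"
proof (rule inj_onI)
  fix u v assume *: "u \<in> cball 0 1" "v \<in> cball 0 1" "motion l u = motion l v"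
  have "(\<lambda>n. 2 * (6/25) ^ n :: real) \<longlonglongrightarrow> 2 * 0" by (intro tendsto_intros LIMSEQ_power_zero) auto
  then have "cmod (u - v) \<le> 2 * 0"
    by (rule LIMSEQ_le_const) (use motion_separation * in auto)
  then show "u = v" by simp
qed

text \<open>Solve the one-step equation for \<open>z\<close>. Off the cells the solution is exact;
  in the cell of \<open>t\<close> the remaining target is a point \<open>u\<close> of the unit disc
  seen at scale \<open>ratio l\<close>, and approximating \<open>u\<close> gains a factor
  3/10.\<close>

lemma motion_dense:
  assumes "cmod y \<le> 1"
  shows "\<exists>z. cmod z \<le> 1 \<and> cmod (motion l z - y) \<le> 2 * (3/10) ^ n"
  using assms
proof (induction n arbitrary: y)
  case 0
  then show ?case using norm_triangle_ineq4[of "motion l 0" y] motion_disc[of 0] by (intro exI[of _ 0]) simp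
next
  case (Suc n)
  obtain z where z: "z + l / 16 * layer 0 z = y" using base_surj by blast
  have z1: "cmod z \<le> 1"
  proof (rule ccontr)
    assume "\<not> cmod z \<le> 1"
    then have "y = z" using layer_zero[of z 0] z by (simp del: layer.simps)
    then show False using Suc.prems \<open>\<not> cmod z \<le> 1\<close> by simp
  qed
  then show ?case
  proof (cases rule: cell_cases)
    case (1 t u)
    have "cmod (6/25 * u) \<le> 6/25" using 1(2) unfolding norm_mult by simp
    from base_digit[OF 1(1) this] have "t + 6/25 * u + l / 16 * (6/25 * u) = y"
      using z 1(3) by (simp only:)
    moreover have "6/25 * u + l / 16 * (6/25 * u) = ratio l * u" by (simp add: ratio_def field_simps)
    ultimately have "y - t = ratio l * u" by (metis add.assoc add_diff_cancel_left')
    moreover obtain v where v: "cmod v \<le> 1" "cmod (motion l v - u) \<le> 2 * (3/10) ^ n"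
      using Suc.IH 1 by blast
    ultimately have "motion l (t + 6/25 * v) - y = ratio l * (motion l v - u)"
      using motion_digit[OF 1(1) v(1)] by (simp add: algebra_simps)
    then have "cmod (motion l (t + 6/25 * v) - y) \<le> 3/10 * (2 * (3/10) ^ n)"
      using ratio_bound v mult_mono[of "cmod (ratio l)" "3/10" "cmod (motion l v - u)" "2 * (3/10) ^ n"]
      by (simp only: norm_mult) simp
    moreover have "cmod (t + 6/25 * v) \<le> 1"
      using norm_triangle_ineq[of t "6/25 * v"] norm_digit[OF 1(1)] v(1) by (simp add: norm_mult)
    ultimately show ?thesis by (intro exI[of _ "t + 6/25 * v"]) simp
  next
    case 2
    then show ?thesis using motion_off_cells z z1 by (intro exI[of _ z]) simp
  qed
qed

text \<open>The image is compact, hence closed, and it is dense by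
  \<open>motion_dense\<close>.\<close>

lemma motion_image_disc: "motion l ` cball 0 1 = cball 0 1"
proof
  show "motion l ` cball 0 1 \<subseteq> cball 0 1" using motion_disc by auto
  have "compact (motion l ` cball 0 1)"
    using continuous_on_motion by (intro compact_continuous_image) (auto intro: continuous_on_subset)
  then have cl: "closure (motion l ` cball 0 1) = motion l ` cball 0 1"
    by (simp add: compact_imp_closed)
  have "y \<in> closure (motion l ` cball 0 1)" if y: "y \<in> cball 0 1" for y
    unfolding closure_approachable
  proof (intro allI impI)
    fix e :: real assume "0 < e"
    have "(\<lambda>n. 2 * (3/10) ^ n :: real) \<longlonglongrightarrow> 2 * 0" by (intro tendsto_intros LIMSEQ_power_zero) auto
    then have "eventually (\<lambda>n. 2 * (3/10) ^ n < e) sequentially"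
      using \<open>0 < e\<close> by (intro order_tendstoD) auto
    then obtain n where "2 * (3/10) ^ n < e" by (auto simp: eventually_sequentially)
    moreover obtain z where "cmod z \<le> 1" "cmod (motion l z - y) \<le> 2 * (3/10) ^ n"
      using motion_dense[of y n] y by auto
    ultimately show "\<exists>x\<in>motion l ` cball 0 1. dist x y < e" by (force simp: dist_norm)
  qed
  then show "cball 0 1 \<subseteq> motion l ` cball 0 1" using cl by blast
qed

section \<open>Images of the holes and of the whole set\<close>

lemma motion_word:
  assumes "w \<in> lists digits" "cmod z \<le> 1"
  shows "motion l (cen (6/25) w + (6/25) ^ length w * z) = cen (ratio l) w + ratio l ^ length w * motion l z"
  using assms(1)
proof induction
  case (Cons t w)
  have "cmod (cen (6/25) w + (6/25) ^ length w * z) \<le> cmod (cen (6/25) w) + (6/25) ^ length w * cmod z"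
    by (rule order_trans[OF norm_triangle_ineq]) (simp add: norm_mult norm_power norm_divide)
  also have "\<dots> \<le> cmod (cen (6/25) w) + (6/25) ^ length w * 1"
    using assms(2) by (intro add_left_mono mult_left_mono) auto
  also have "\<dots> \<le> 1" using cen_bound[of "6/25" w] Cons by simp
  finally have "cmod (cen (6/25) w + (6/25) ^ length w * z) \<le> 1" .
  from motion_digit[OF Cons(1) this] show ?case
    using Cons by (simp add: algebra_simps)
qed simp

text \<open>\<open>rad a n\<close> is |a|^n times a radius independent of \<open>a\<close> and at
  most 1/20. A hole is therefore the affine copy of a small disc about 0, on which the motion is the
  identity, and \<open>motion_word\<close> replaces one affine map by the other.\<close>

lemma motion_hole:
  assumes "w \<in> lists digits"
  shows "motion l ` ball (cen (6/25) w) (rad (6/25) (length w)) = ball (cen (ratio l) w) (rad (ratio l) (length w))"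
proof -
  define n where "n = length w"
  have ball: "ball (cen a w) (rad a n) = (\<lambda>x. cen a w + a ^ n * x) ` ball 0 ((1/8) ^ n / 20)" if "a \<noteq> 0" for a :: complex
  proof -
    have "ball (cen a w) (rad a n) = (+) (cen a w) ` ((\<lambda>x. a ^ n * x) ` ball 0 ((1/8) ^ n / 20))"
    proof -
      have "(\<lambda>x. a ^ n * x) ` ball 0 ((1/8) ^ n / 20) = ball 0 (rad a n)"
      proof (intro equalityI subsetI)
        fix x :: complex assume "x \<in> ball 0 (rad a n)"
        then show "x \<in> (\<lambda>x. a ^ n * x) ` ball 0 ((1/8) ^ n / 20)"
          using that by (intro image_eqI[of _ _ "x / a ^ n"])
            (auto simp: rad_def norm_divide norm_power power_divide field_simps)
      qed (use that in \<open>auto simp: rad_def norm_mult norm_power power_divide field_simps\<close>)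
      then show ?thesis by simp
    qed
    then show ?thesis by (simp add: image_image)
  qed
  have le: "(1/8) ^ n / 20 \<le> (1/20 :: real)" by (simp add: power_le_one)
  have "motion l (cen (6/25) w + (6/25) ^ n * x) = cen (ratio l) w + ratio l ^ n * x" if "x \<in> ball 0 ((1/8) ^ n / 20)" for x
  proof -
    have "cmod x \<le> 1/20" using that le by simp
    then show ?thesis using motion_word[OF assms, of x] motion_small[of x] n_def by simp
  qed
  then show ?thesis
    unfolding n_def[symmetric] using ball[OF ratio_nz] ball[of "6/25"] by (simp add: image_image)
qed

lemma motion_cheese: "motion l ` cheese (6/25) = cheese (ratio l)"
proof -
  have sub: "ball (cen (6/25) w) (rad (6/25) (length w)) \<subseteq> cball 0 1" if "w \<in> lists digits" for w
  proof
    fix z assume "z \<in> ball (cen (6/25) w) (rad (6/25) (length w))"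
    then have "cmod (z - cen (6/25) w) < rad (6/25) (length w)" by (simp add: dist_norm norm_minus_commute)
    also have "\<dots> \<le> cmod (6/25) ^ length w / 20" by (rule rad_le)
    also have "\<dots> \<le> cmod (6/25) ^ length w" by simp
    finally show "z \<in> cball 0 1"
      using cen_bound[of "6/25" w] that norm_triangle_ineq[of "cen (6/25) w" "z - cen (6/25) w"] by simp
  qed
  have "motion l ` cheese (6/25) = motion l ` cball 0 1 - motion l ` (\<Union>w\<in>lists digits. ball (cen (6/25) w) (rad (6/25) (length w)))"
    unfolding cheese_def using sub by (intro inj_on_image_set_diff[OF motion_inj]) auto
  then show ?thesis unfolding image_UN by (simp add: motion_image_disc motion_hole cheese_def)
qed

end

lemma holomorphic_motion_motion: "holomorphic_motion (cheese (6/25)) motion"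
  unfolding holomorphic_motion_def
proof (intro conjI ballI)
  show "motion 0 z = z" for z by (simp add: motion_def)
  show "inj_on (motion w) (cheese (6/25))" if "w \<in> ball 0 1" for w
    using motion_inj[of w] that by (auto simp: cheese_def intro: inj_on_subset)
  fix z
  \<comment> \<open>For fixed \<open>z\<close> the layers are constant coefficients; only the powers
    of \<open>ratio w\<close> depend on the parameter, and the series converges uniformly on discs
    inside the parameter disc.\<close>
  have "(\<lambda>w. \<Sum>k. ratio w ^ k * layer k z) holomorphic_on ball 0 1"
  proof (rule holomorphic_uniform_sequence[OF open_ball])
    show "(\<lambda>w. \<Sum>k<n. ratio w ^ k * layer k z) holomorphic_on ball 0 1" for n
      unfolding ratio_def by (intro holomorphic_intros) auto
    fix x :: complex assume "x \<in> ball 0 1"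
    then obtain d where d: "0 < d" "cball x d \<subseteq> ball 0 1"
      using open_contains_cball_eq[OF open_ball] by blast
    moreover have "uniform_limit (cball x d) (\<lambda>n w. \<Sum>k<n. ratio w ^ k * layer k z) (\<lambda>w. \<Sum>k. ratio w ^ k * layer k z) sequentially"
      by (rule Weierstrass_m_test[of _ _ "\<lambda>k. 2/5 * (3/10) ^ k"]) (use norm_term d in auto)
    ultimately show "\<exists>d>0. cball x d \<subseteq> ball 0 1 \<and>
        uniform_limit (cball x d) (\<lambda>n w. \<Sum>k<n. ratio w ^ k * layer k z) (\<lambda>w. \<Sum>k. ratio w ^ k * layer k z) sequentially"
      by blast
  qed
  then show "(\<lambda>w. motion w z) holomorphic_on ball 0 1"
    unfolding motion_def by (intro holomorphic_intros) auto
qed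

section \<open>Laurent splitting in circle domains\<close>

definition cauchy_int :: "complex \<Rightarrow> real \<Rightarrow> (complex \<Rightarrow> complex) \<Rightarrow> complex \<Rightarrow> complex" where
  "cauchy_int c r f z = contour_integral (circlepath c r) (\<lambda>u. f u / (u - z)) / (2 * pi * \<i>)"

section \<open>Cauchy integrals over circles\<close>

lemma contour_integral_circlepath_radius:
  assumes "open S" "f holomorphic_on S" "0 < r" "r \<le> R"
    and S: "\<And>x. r \<le> cmod (x - c) \<Longrightarrow> cmod (x - c) \<le> R \<Longrightarrow> x \<in> S"
  shows "contour_integral (circlepath c r) f = contour_integral (circlepath c R) f"
proof (rule Cauchy_theorem_homotopic_loops[OF _ assms(1,2)])
  show "homotopic_loops S (circlepath c r) (circlepath c R)"
  proof (rule homotopic_loops_linear)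
    fix t :: real assume "t \<in> {0..1}"
    show "closed_segment (circlepath c r t) (circlepath c R t) \<subseteq> S"
    proof
      fix x assume "x \<in> closed_segment (circlepath c r t) (circlepath c R t)"
      then obtain v where v: "0 \<le> v" "v \<le> 1"
        and x: "x = (1 - v) *\<^sub>R circlepath c r t + v *\<^sub>R circlepath c R t"
        by (auto simp: in_segment)
      define q where "q = (1 - v) * r + v * R"
      have q: "r \<le> q" "q \<le> R"
      proof -
        have "0 \<le> v * (R - r)" "0 \<le> (1 - v) * (R - r)" using v assms(4) by auto
        then show "r \<le> q" "q \<le> R" by (auto simp: q_def algebra_simps)
      qed
      have "x - c = of_real q * exp (2 * of_real pi * \<i> * of_real t)"
        by (simp add: x q_def circlepath scaleR_conv_of_real algebra_simps)
      then have "cmod (x - c) = q"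
        using q assms(3) by (simp add: norm_mult)
      then show "x \<in> S" using S q by simp
    qed
  qed auto
qed auto

lemma cauchy_int_integrable:
  assumes "continuous_on (sphere c r) f" "0 < r" "cmod (z - c) \<noteq> r"
  shows "(\<lambda>u. f u / (u - z)) contour_integrable_on circlepath c r"
  by (rule contour_integrable_continuous_circlepath)
     (use assms in \<open>auto intro!: continuous_intros simp: dist_norm norm_minus_commute\<close>)

lemma cauchy_int_bound:
  assumes "continuous_on (sphere c r) f" "0 < r" "r < cmod (z - c)" "0 \<le> M"
    and M: "\<And>u. cmod (u - c) = r \<Longrightarrow> cmod (f u) \<le> M"
  shows "cmod (cauchy_int c r f z) \<le> M * r / (cmod (z - c) - r)"
proof -
  have "cmod (contour_integral (circlepath c r) (\<lambda>u. f u / (u - z))) \<le> M / (cmod (z - c) - r) * (2 * pi * r)"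
  proof (rule has_contour_integral_bound_circlepath)
    show "((\<lambda>u. f u / (u - z)) has_contour_integral contour_integral (circlepath c r) (\<lambda>u. f u / (u - z))) (circlepath c r)"
      using cauchy_int_integrable assms by (intro has_contour_integral_integral) auto
    fix u assume u: "cmod (u - c) = r"
    have "cmod (z - c) - r \<le> cmod (u - z)"
      using norm_triangle_ineq2[of "z - c" "u - c"] u by (simp add: norm_minus_commute)
    then show "cmod (f u / (u - z)) \<le> M / (cmod (z - c) - r)"
      unfolding norm_divide using assms(3,4) M[OF u] by (intro frac_le) auto
  qed (use assms in auto)
  from divide_right_mono[OF this, of "2 * pi"] show ?thesis
    by (simp add: cauchy_int_def norm_divide norm_mult)
qed

lemma holomorphic_cauchy_int:
  assumes "continuous_on (sphere c r) f" "0 < r"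
  shows "cauchy_int c r f holomorphic_on - sphere c r"
proof -
  have "(\<lambda>z. contour_integral (circlepath c r) (\<lambda>u. f u / (u - z))) holomorphic_on - sphere c r"
  proof (rule holomorphic_onI)
    fix z assume z: "z \<in> - sphere c r"
    have "((\<lambda>z. contour_integral (circlepath c r) (\<lambda>u. f u / (u - z))) has_field_derivative
        (of_nat 1 * contour_integral (circlepath c r) (\<lambda>u. f u / (u - z) ^ Suc 1))) (at z)"
    proof (rule Cauchy_next_derivative(2)[of "circlepath c r" f "2 * pi * r" UNIV 1])
      show "cmod (vector_derivative (circlepath c r) (at t)) \<le> 2 * pi * r" for t
        using assms(2) by (simp add: vector_derivative_circlepath norm_mult)
      show "((\<lambda>u. f u / (u - w) ^ 1) has_contour_integral contour_integral (circlepath c r) (\<lambda>u. f u / (u - w))) (circlepath c r)"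
        if "w \<in> UNIV - path_image (circlepath c r)" for w
      proof -
        have "cmod (w - c) \<noteq> r"
          using that assms(2) by (auto simp: dist_norm norm_minus_commute)
        then show ?thesis
          using cauchy_int_integrable[OF assms] has_contour_integral_integral by auto
      qed
    qed (use assms z in auto)
    then show "(\<lambda>z. contour_integral (circlepath c r) (\<lambda>u. f u / (u - z))) field_differentiable at z within - sphere c r"
      by (meson field_differentiable_at_within field_differentiable_def)
  qed
  then show ?thesis unfolding cauchy_int_def by (intro holomorphic_intros) auto
qed

lemma contour_integral_circlepath_zero:
  assumes "f holomorphic_on S" "cball c r \<subseteq> S" "0 \<le> r"
  shows "(f has_contour_integral 0) (circlepath c r)"
proof (rule Cauchy_theorem_disc[of "{}" c r])
  show "continuous_on (cball c r) f"
    using assms holomorphic_on_imp_continuous_on holomorphic_on_subset by blast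
  have "f holomorphic_on ball c r"
    using assms ball_subset_cball by (blast intro: holomorphic_on_subset)
  then show "f field_differentiable at x" if "x \<in> ball c r - {}" for x
    using that holomorphic_on_imp_differentiable_at by auto
qed (use assms in auto)

lemma cauchy_int_cong:
  assumes "\<And>u. cmod (u - c) = r \<Longrightarrow> f u = g u" "0 < r"
  shows "cauchy_int c r f z = cauchy_int c r g z"
proof -
  have "contour_integral (circlepath c r) (\<lambda>u. f u / (u - z)) = contour_integral (circlepath c r) (\<lambda>u. g u / (u - z))"
    by (rule contour_integral_eq) (use assms in \<open>auto simp: dist_norm norm_minus_commute\<close>)
  then show ?thesis by (simp add: cauchy_int_def)
qed

lemma cauchy_int_add:
  assumes "continuous_on (sphere c r) f" "continuous_on (sphere c r) g" "0 < r" "cmod (z - c) \<noteq> r"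
  shows "cauchy_int c r (\<lambda>u. f u + g u) z = cauchy_int c r f z + cauchy_int c r g z"
  using cauchy_int_integrable[OF assms(1,3,4)] cauchy_int_integrable[OF assms(2,3,4)]
  by (simp add: cauchy_int_def add_divide_distrib contour_integral_add)

lemma cauchy_int_outside:
  assumes "f holomorphic_on S" "cball c r \<subseteq> S" "z \<notin> cball c r" "0 \<le> r"
  shows "cauchy_int c r f z = 0"
proof -
  have "((\<lambda>u. f u / (u - z)) has_contour_integral 0) (circlepath c r)"
    by (rule contour_integral_circlepath_zero[of _ "S - {z}"])
       (use assms in \<open>auto intro!: holomorphic_intros intro: holomorphic_on_subset\<close>)
  then show ?thesis by (simp add: cauchy_int_def contour_integral_unique)
qed

text \<open>Independence of the radius applies to the difference quotient of \<open>f\<close> at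
  \<open>z\<close>, whose singularity is removable. The subtracted constant \<open>f z\<close>
  contributes 2 pi i \<open>f z\<close> on the outer circle and 0 on the inner one.\<close>

lemma cauchy_int_jump:
  assumes "open S" "f holomorphic_on S" "0 < r" "r < R" "r < cmod (z - c)" "cmod (z - c) < R"
    and S: "\<And>x. r \<le> cmod (x - c) \<Longrightarrow> cmod (x - c) \<le> R \<Longrightarrow> x \<in> S"
  shows "f z = cauchy_int c R f z - cauchy_int c r f z"
proof -
  define h where "h u = (if u = z then deriv f z else (f u - f z) / (u - z))" for u
  have "h holomorphic_on S"
    unfolding h_def using pole_lemma_open[OF assms(2,1)] .
  then have h: "contour_integral (circlepath c r) h = contour_integral (circlepath c R) h"
    using assms by (intro contour_integral_circlepath_radius[of S]) auto
  have sph: "sphere c r \<subseteq> S" "sphere c R \<subseteq> S"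
    using S assms(4) by (auto simp: dist_norm norm_minus_commute)
  have cont: "continuous_on (sphere c r) f" "continuous_on (sphere c R) f"
    using holomorphic_on_imp_continuous_on[OF assms(2)] sph continuous_on_subset by blast+
  have expand: "contour_integral (circlepath c q) h
      = contour_integral (circlepath c q) (\<lambda>u. f u / (u - z)) - contour_integral (circlepath c q) (\<lambda>u. f z / (u - z))"
    if "continuous_on (sphere c q) f" "0 < q" "cmod (z - c) \<noteq> q" for q
  proof -
    have "contour_integral (circlepath c q) h = contour_integral (circlepath c q) (\<lambda>u. f u / (u - z) - f z / (u - z))"
      by (rule contour_integral_eq)
        (use that in \<open>auto simp: h_def dist_norm norm_minus_commute diff_divide_distrib\<close>)
    also have "\<dots> = contour_integral (circlepath c q) (\<lambda>u. f u / (u - z)) - contour_integral (circlepath c q) (\<lambda>u. f z / (u - z))"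
      by (intro contour_integral_diff cauchy_int_integrable that continuous_on_const)
    finally show ?thesis .
  qed
  have "contour_integral (circlepath c R) (\<lambda>u. f z / (u - z)) = 2 * of_real pi * \<i> * f z"
    using Cauchy_integral_circlepath_simple[of "\<lambda>_. f z" c R z] assms
    by (simp add: contour_integral_unique)
  moreover have "cauchy_int c r (\<lambda>_. f z) z = 0"
    by (rule cauchy_int_outside[of _ UNIV]) (use assms in \<open>auto simp: dist_norm norm_minus_commute\<close>)
  then have "contour_integral (circlepath c r) (\<lambda>u. f z / (u - z)) = 0"
    by (simp add: cauchy_int_def)
  ultimately have "contour_integral (circlepath c R) (\<lambda>u. f u / (u - z)) - contour_integral (circlepath c r) (\<lambda>u. f u / (u - z))
      = 2 * of_real pi * \<i> * f z"
    using h expand[OF cont(1)] expand[OF cont(2)] assms by simp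
  then show ?thesis
    unfolding cauchy_int_def by (simp flip: diff_divide_distrib)
qed

text \<open>\<open>G\<close> is minus the Cauchy integral over any circle between the hole and
  \<open>z\<close>, and \<open>F\<close> is the Cauchy integral over the outer circle. Away from
  that circle's disc \<open>F\<close> is continued as \<open>f - G\<close>, which agrees with it on
  the overlap by \<open>cauchy_int_jump\<close>.\<close>

lemma laurent_split:
  assumes "open U" "0 < s" "s < t" "cball c t \<subseteq> U" "f holomorphic_on U - cball c s"
  obtains F G where "F holomorphic_on U" "G holomorphic_on - cball c s"
    "\<And>z. z \<in> U - cball c s \<Longrightarrow> f z = F z + G z"
    "\<And>z. z \<notin> cball c t \<Longrightarrow> G z = - cauchy_int c t f z"
proof -
  have openA: "open (U - cball c s)" using assms(1) by auto
  have A: "x \<in> U - cball c s" if "s < cmod (x - c)" "cmod (x - c) \<le> t" for x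
    using that assms(4) by (auto simp: dist_norm norm_minus_commute subset_iff)
  have cont: "continuous_on (sphere c r) f" if "s < r" "r \<le> t" for r
    using holomorphic_on_imp_continuous_on[OF assms(5)] A that
    by (auto simp: dist_norm norm_minus_commute elim!: continuous_on_subset)
  have indep: "cauchy_int c r f z = cauchy_int c r' f z" if "s < r" "r \<le> r'" "r' \<le> t" "r' < cmod (z - c)" for r r' z
  proof -
    have "(\<lambda>u. f u / (u - z)) holomorphic_on (U - cball c s) - {z}"
      using assms(5) by (auto intro!: holomorphic_intros intro: holomorphic_on_subset)
    then have "contour_integral (circlepath c r) (\<lambda>u. f u / (u - z)) = contour_integral (circlepath c r') (\<lambda>u. f u / (u - z))"
      using openA A that assms(2) by (intro contour_integral_circlepath_radius) (auto simp: open_delete)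
    then show ?thesis by (simp add: cauchy_int_def)
  qed
  \<comment> \<open>For \<open>z\<close> outside the closed hole the radius lies strictly between
    \<open>s\<close> and \<open>cmod (z - c)\<close> and does not exceed \<open>t\<close>. It may
    vary with \<open>z\<close>, since by \<open>indep\<close> the value does not depend on
    it.\<close>
  define G where "G z = - cauchy_int c (min t ((s + cmod (z - c)) / 2)) f z" for z
  have G: "G z = - cauchy_int c r f z" if "s < r" "r \<le> t" "r < cmod (z - c)" for z r
  proof -
    define r' where "r' = min t ((s + cmod (z - c)) / 2)"
    have "s < cmod (z - c)" using that by linarith
    then have "s < r'" "r' \<le> t" "r' < cmod (z - c)"
      using assms(3) by (auto simp: r'_def min_less_iff_disj)
    then have "cauchy_int c r' f z = cauchy_int c r f z"
    proof (cases "r \<le> r'")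
      case True
      then show ?thesis using indep[of r r' z] that \<open>r' \<le> t\<close> \<open>r' < cmod (z - c)\<close> by simp
    next
      case False
      then show ?thesis using indep[of r' r z] that \<open>s < r'\<close> by simp
    qed
    then show ?thesis by (simp add: G_def r'_def)
  qed
  define F where "F z = (if z \<in> ball c t then cauchy_int c t f z else f z - G z)" for z
  have fFG: "f z = F z + G z" if "z \<in> U - cball c s" for z
  proof (cases "z \<in> ball c t")
    case True
    have z: "s < cmod (z - c)" "cmod (z - c) < t"
      using that True by (auto simp: dist_norm norm_minus_commute)
    define r where "r = (s + cmod (z - c)) / 2"
    have "f z = cauchy_int c t f z - cauchy_int c r f z"
      by (rule cauchy_int_jump[OF openA assms(5)]) (use z A assms(2) in \<open>auto simp: r_def\<close>)
    then show ?thesis using G[of r z] z True by (simp add: F_def r_def)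
  qed (simp add: F_def)
  have holG: "G holomorphic_on - cball c s"
  proof -
    have "G holomorphic_on (\<Union>r\<in>{s<..<t}. - cball c r)"
    proof (rule holomorphic_on_UN_open)
      fix r assume r: "r \<in> {s<..<t}"
      have "cauchy_int c r f holomorphic_on - cball c r"
        using holomorphic_cauchy_int[OF cont, of r] r assms(2) by (auto intro: holomorphic_on_subset)
      then have "(\<lambda>z. - cauchy_int c r f z) holomorphic_on - cball c r"
        by (intro holomorphic_intros)
      then show "G holomorphic_on - cball c r"
        by (rule holomorphic_transform) (use r G in \<open>auto simp: dist_norm norm_minus_commute\<close>)
    qed auto
    moreover have "- cball c s \<subseteq> (\<Union>r\<in>{s<..<t}. - cball c r)"
    proof
      fix z assume "z \<in> - cball c s"
      then have "s < dist c z" by auto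
      then obtain r where "s < r" "r < min t (dist c z)" using dense[of s "min t (dist c z)"] assms(3) by auto
      then show "z \<in> (\<Union>r\<in>{s<..<t}. - cball c r)" by (intro UN_I[of r]) auto
    qed
    ultimately show ?thesis by (rule holomorphic_on_subset)
  qed
  have "F holomorphic_on ball c t \<union> (U - cball c s)"
  proof (rule holomorphic_on_Un)
    have "cauchy_int c t f holomorphic_on ball c t"
      using holomorphic_cauchy_int[OF cont, of t] assms(2,3) by (auto intro: holomorphic_on_subset)
    then show "F holomorphic_on ball c t" by (rule holomorphic_transform) (simp add: F_def)
    have "(\<lambda>z. f z - G z) holomorphic_on U - cball c s"
      using holG assms(5) by (auto intro!: holomorphic_intros intro: holomorphic_on_subset)
    then show "F holomorphic_on U - cball c s"
      by (rule holomorphic_transform) (use fFG in simp)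
  qed (use assms(1) in auto)
  moreover have "U \<subseteq> ball c t \<union> (U - cball c s)" using assms(3) by auto
  ultimately have "F holomorphic_on U" by (rule holomorphic_on_subset)
  then show ?thesis
    using holG fFG G[of t] assms(3) by (intro that[of F G]) (auto simp: dist_norm norm_minus_commute)
qed

text \<open>\<open>F\<close> is still missing outside \<open>U\<close>, and \<open>G\<close> on the
  circle bounding the hole. Each is completed there by the difference of \<open>f\<close> and the
  other function, which is continuous across, and relatively open overlaps glue the pieces.\<close>

lemma laurent_split_boundary:
  assumes "open U" "U \<subseteq> X" "0 < s" "s < t" "cball c t \<subseteq> U"
    and f: "f holomorphic_on U - cball c s" "continuous_on (X - ball c s) f"
  obtains F G where "continuous_on X F" "F holomorphic_on U"
    "continuous_on (- ball c s) G" "G holomorphic_on - cball c s"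
    "\<And>z. z \<in> X - ball c s \<Longrightarrow> f z = F z + G z"
    "\<And>z. z \<notin> cball c t \<Longrightarrow> G z = - cauchy_int c t f z"
proof -
  obtain F G where FG: "F holomorphic_on U" "G holomorphic_on - cball c s"
    "\<And>z. z \<in> U - cball c s \<Longrightarrow> f z = F z + G z"
    "\<And>z. z \<notin> cball c t \<Longrightarrow> G z = - cauchy_int c t f z"
    using laurent_split[OF assms(1,3-5) f(1)] by blast
  define F' where "F' z = (if z \<in> U then F z else f z - G z)" for z
  define G' where "G' z = (if z \<notin> cball c s then G z else f z - F z)" for z
  have cs: "cball c s \<subseteq> U" using assms(4,5) by (force simp: subset_iff)
  have "continuous_on (U \<union> (X - cball c s)) F'"
  proof (rule continuous_on_Un_local_open)
    have UX: "U \<union> (X - cball c s) = X" using assms(2) cs by auto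
    show "openin (top_of_set (U \<union> (X - cball c s))) U"
      unfolding UX using assms(1,2) by (simp add: open_subset)
    show "openin (top_of_set (U \<union> (X - cball c s))) (X - cball c s)"
      unfolding UX using openin_open_Int[of "- cball c s" X] by (simp add: Diff_eq open_Compl)
    show "continuous_on U F'"
      using holomorphic_on_imp_continuous_on[OF FG(1)] by (rule continuous_on_eq) (simp add: F'_def)
    have "continuous_on (X - cball c s) (\<lambda>z. f z - G z)"
      using f(2) holomorphic_on_imp_continuous_on[OF FG(2)]
      by (intro continuous_on_diff) (auto elim!: continuous_on_subset)
    then show "continuous_on (X - cball c s) F'"
      by (rule continuous_on_eq) (use FG(3) in \<open>auto simp: F'_def\<close>)
  qed
  then have 1: "continuous_on X F'" by (rule continuous_on_subset) (use assms(2) cs in auto)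
  have 2: "F' holomorphic_on U" using FG(1) by (rule holomorphic_transform) (simp add: F'_def)
  have "continuous_on (- cball c s \<union> (U - ball c s)) G'"
  proof (rule continuous_on_Un_local_open)
    have eq: "- cball c s \<union> (U - ball c s) = - ball c s" using cs by auto
    show "openin (top_of_set (- cball c s \<union> (U - ball c s))) (- cball c s)"
      unfolding eq by (intro open_subset) auto
    show "openin (top_of_set (- cball c s \<union> (U - ball c s))) (U - ball c s)"
      unfolding eq using openin_open_Int[OF assms(1), of "- ball c s"] by (simp add: Diff_eq Int_commute)
    show "continuous_on (- cball c s) G'"
      using holomorphic_on_imp_continuous_on[OF FG(2)] by (rule continuous_on_eq) (simp add: G'_def)
    have "continuous_on (U - ball c s) (\<lambda>z. f z - F z)"
      using f(2) holomorphic_on_imp_continuous_on[OF FG(1)] assms(2)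
      by (intro continuous_on_diff) (auto elim!: continuous_on_subset)
    then show "continuous_on (U - ball c s) G'"
      by (rule continuous_on_eq) (use FG(3) in \<open>auto simp: G'_def\<close>)
  qed
  then have 3: "continuous_on (- ball c s) G'" by (rule continuous_on_subset) (use cs in auto)
  have 4: "G' holomorphic_on - cball c s"
    using FG(2) by (rule holomorphic_transform) (simp add: G'_def)
  have 5: "f z = F' z + G' z" if "z \<in> X - ball c s" for z
    using FG(3) cs by (auto simp: F'_def G'_def)
  have 6: "G' z = - cauchy_int c t f z" if "z \<notin> cball c t" for z
    using FG(4) that assms(4) by (auto simp: G'_def)
  show ?thesis using that[OF 1 2 3 4 5 6] .
qed

text \<open>One hole is split off in the domain with all the others removed. The remainder is
  holomorphic across that hole, so the induction hypothesis splits it at the other holes.\<close>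

lemma circle_domain_split:
  assumes "finite I" "open U" "U \<subseteq> X"
    and "\<And>i. i \<in> I \<Longrightarrow> 0 < s i \<and> s i < t i \<and> cball (c i) (t i) \<subseteq> U"
    and "\<And>i j. i \<in> I \<Longrightarrow> j \<in> I \<Longrightarrow> i \<noteq> j \<Longrightarrow> cball (c i) (t i) \<inter> cball (c j) (t j) = {}"
    and "f holomorphic_on U - (\<Union>i\<in>I. cball (c i) (s i))"
    and "continuous_on (X - (\<Union>i\<in>I. ball (c i) (s i))) f"
  shows "\<exists>F G. continuous_on X F \<and> F holomorphic_on U \<and>
    (\<forall>i\<in>I. continuous_on (- ball (c i) (s i)) (G i) \<and> G i holomorphic_on - cball (c i) (s i) \<and>
      (\<forall>z. z \<notin> cball (c i) (t i) \<longrightarrow> G i z = - cauchy_int (c i) (t i) f z)) \<and>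
    (\<forall>z\<in>X - (\<Union>i\<in>I. ball (c i) (s i)). f z = F z + (\<Sum>i\<in>I. G i z))"
  using assms(1,4-)
proof (induction I arbitrary: f rule: finite_induct)
  case empty
  then show ?case by (intro exI[of _ f]) auto
next
  case (insert j I f)
  define U' where "U' = U - (\<Union>i\<in>I. cball (c i) (s i))"
  define X' where "X' = X - (\<Union>i\<in>I. ball (c i) (s i))"
  have st: "0 < s i" "s i < t i" "cball (c i) (t i) \<subseteq> U" if "i \<in> insert j I" for i
    using insert.prems(1)[OF that] by auto
  have disj: "cball (c i) (t i) \<inter> cball (c j) (t j) = {}" if "i \<in> I" for i
    using insert.prems(2)[of i j] insert.hyps that by auto
  have "closed (\<Union>i\<in>I. cball (c i) (s i))" using insert.hyps by auto
  then have openU': "open U'" using assms(2) by (auto simp: U'_def)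
  have UX': "U' \<subseteq> X'" using assms(3) by (auto simp: U'_def X'_def)
  have jU': "cball (c j) (t j) \<subseteq> U'"
  proof -
    have "cball (c i) (s i) \<subseteq> cball (c i) (t i)" if "i \<in> I" for i
      using st[of i] that by (simp add: subset_cball)
    then show ?thesis using st(3)[of j] disj unfolding U'_def by blast
  qed
  have sj: "0 < s j" "s j < t j" using st[of j] by auto
  have f': "f holomorphic_on U' - cball (c j) (s j)" "continuous_on (X' - ball (c j) (s j)) f"
    using insert.prems(3,4) by (auto simp: U'_def X'_def Un_commute set_diff_eq elim!: back_subst[of "\<lambda>S. f holomorphic_on S"] back_subst[of "\<lambda>S. continuous_on S f"])
  obtain F1 Gj where FG: "continuous_on X' F1" "F1 holomorphic_on U'"
    "continuous_on (- ball (c j) (s j)) Gj" "Gj holomorphic_on - cball (c j) (s j)"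
    "\<And>z. z \<in> X' - ball (c j) (s j) \<Longrightarrow> f z = F1 z + Gj z"
    "\<And>z. z \<notin> cball (c j) (t j) \<Longrightarrow> Gj z = - cauchy_int (c j) (t j) f z"
    using laurent_split_boundary[OF openU' UX' sj jU' f'] by blast
  have *: "\<And>i. i \<in> I \<Longrightarrow> 0 < s i \<and> s i < t i \<and> cball (c i) (t i) \<subseteq> U"
    "\<And>i j. i \<in> I \<Longrightarrow> j \<in> I \<Longrightarrow> i \<noteq> j \<Longrightarrow> cball (c i) (t i) \<inter> cball (c j) (t j) = {}"
    using insert.prems(1,2) by auto
  obtain F G where IH: "continuous_on X F" "F holomorphic_on U"
    "\<And>i. i \<in> I \<Longrightarrow> continuous_on (- ball (c i) (s i)) (G i) \<and> G i holomorphic_on - cball (c i) (s i) \<and>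
      (\<forall>z. z \<notin> cball (c i) (t i) \<longrightarrow> G i z = - cauchy_int (c i) (t i) F1 z)"
    "\<And>z. z \<in> X' \<Longrightarrow> F1 z = F z + (\<Sum>i\<in>I. G i z)"
    using insert.IH[OF * FG(2)[unfolded U'_def] FG(1)[unfolded X'_def], folded X'_def] by blast
  define G' where "G' = G(j := Gj)"
  \<comment> \<open>The induction hypothesis gives the Cauchy integral of the remainder
    \<open>F1\<close> instead of \<open>f\<close>. The difference \<open>Gj\<close> is holomorphic
    on the disc about hole \<open>i\<close>, so its integral vanishes for \<open>z\<close>
    outside.\<close>
  have G'I: "G' i z = - cauchy_int (c i) (t i) f z" if i: "i \<in> I" and z: "z \<notin> cball (c i) (t i)" for i z
  proof -
    have sub: "cball (c i) (t i) \<subseteq> - cball (c j) (s j)" using disj[OF i] sj by auto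
    have sph: "sphere (c i) (t i) \<subseteq> X'"
    proof -
      have "sphere (c i) (t i) \<inter> ball (c k) (s k) = {}" if "k \<in> I" for k
      proof (cases "k = i")
        case True
        then show ?thesis using st[of i] i by auto
      next
        case False
        have "cball (c k) (t k) \<inter> cball (c i) (t i) = {}"
          using insert.prems(2) False i that by auto
        moreover have "ball (c k) (s k) \<subseteq> cball (c k) (t k)" using st[of k] that by auto
        ultimately show ?thesis using sphere_cball by blast
      qed
      then show ?thesis using st(3)[of i] i assms(3) sphere_cball unfolding X'_def by blast
    qed
    have "cauchy_int (c i) (t i) f z = cauchy_int (c i) (t i) (\<lambda>u. F1 u + Gj u) z"
    proof (rule cauchy_int_cong)
      fix u assume "cmod (u - c i) = t i"
      then have "u \<in> sphere (c i) (t i)" by (simp add: dist_norm norm_minus_commute)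
      then have "u \<in> X' - ball (c j) (s j)" using sph sub sphere_cball by fastforce
      then show "f u = F1 u + Gj u" using FG(5) by blast
    qed (use st[of i] i in auto)
    also have "\<dots> = cauchy_int (c i) (t i) F1 z + cauchy_int (c i) (t i) Gj z"
    proof (rule cauchy_int_add)
      show "continuous_on (sphere (c i) (t i)) F1" using FG(1) sph continuous_on_subset by blast
      show "continuous_on (sphere (c i) (t i)) Gj"
        using holomorphic_on_imp_continuous_on[OF FG(4)] sub sphere_cball continuous_on_subset by blast
    qed (use st[of i] i z in \<open>auto simp: dist_norm norm_minus_commute\<close>)
    also have "cauchy_int (c i) (t i) Gj z = 0"
      by (rule cauchy_int_outside[OF FG(4) sub z]) (use st[of i] i in auto)
    finally show ?thesis using IH(3)[OF i] z i insert.hyps by (auto simp: G'_def)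
  qed
  show ?case
  proof (intro exI[of _ F] exI[of _ G'] conjI ballI IH(1,2) allI impI)
    fix i assume "i \<in> insert j I"
    then show "continuous_on (- ball (c i) (s i)) (G' i)" "G' i holomorphic_on - cball (c i) (s i)"
      using IH(3)[of i] FG(3,4) by (auto simp: G'_def)
    fix z assume "z \<notin> cball (c i) (t i)"
    then show "G' i z = - cauchy_int (c i) (t i) f z"
      using G'I[of i z] FG(6)[of z] \<open>i \<in> insert j I\<close> by (cases "i = j") (simp_all add: G'_def)
  next
    fix z assume "z \<in> X - (\<Union>i\<in>insert j I. ball (c i) (s i))"
    then have "z \<in> X' - ball (c j) (s j)" by (auto simp: X'_def)
    then have "f z = F z + (\<Sum>i\<in>I. G i z) + Gj z" using FG(5) IH(4) by auto
    also have "(\<Sum>i\<in>I. G i z) = (\<Sum>i\<in>I. G' i z)"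
      using insert.hyps by (intro sum.cong) (auto simp: G'_def)
    finally show "f z = F z + (\<Sum>i\<in>insert j I. G' i z)"
      using insert.hyps by (simp add: G'_def)
  qed
qed

section \<open>Uniform rational approximation\<close>

text \<open>The dilate \<open>F (s z)\<close> with \<open>s\<close> slightly below 1 is uniformly
  close to \<open>F\<close> and holomorphic on a disc of radius \<open>1 / s\<close> > 1, so its
  Taylor polynomials converge uniformly on the closed unit disc.\<close>

lemma disc_poly_approx:
  assumes "continuous_on (cball 0 1) F" "F holomorphic_on ball 0 1" "0 < e"
  obtains p where "\<And>z. z \<in> cball 0 1 \<Longrightarrow> cmod (F z - poly p z) < e"
proof -
  have "uniformly_continuous_on (cball 0 1) F"
    using assms(1) by (intro compact_uniformly_continuous) auto
  then obtain d where d: "0 < d"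
    "\<And>x y. x \<in> cball 0 1 \<Longrightarrow> y \<in> cball 0 1 \<Longrightarrow> dist y x < d \<Longrightarrow> dist (F y) (F x) < e/2"
    using assms(3) unfolding uniformly_continuous_on_def by (metis half_gt_zero)
  define s where "s = 1 - min (1/2) (d/2)"
  have s: "0 < s" "s < 1" "1 - s < d" using d(1) by (auto simp: s_def min_def)
  define g where "g z = F (of_real s * z)" for z
  have near: "cmod (F z - g z) < e/2" if "z \<in> cball 0 1" for z
  proof -
    have "cmod z \<le> 1" using that by simp
    have "cmod (z - of_real s * z) = (1 - s) * cmod z"
    proof -
      have "z - of_real s * z = of_real (1 - s) * z" by (simp add: algebra_simps)
      then show ?thesis using s by (metis abs_of_pos diff_gt_0_iff_gt norm_mult norm_of_real)
    qed
    also have "\<dots> \<le> (1 - s) * 1" using that s by (intro mult_left_mono) auto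
    finally have "dist z (of_real s * z) < d" using s(3) by (simp add: dist_norm)
    moreover have "of_real s * z \<in> cball 0 1"
      using that s by (simp add: norm_mult mult_le_one)
    ultimately show ?thesis using d(2)[of "of_real s * z" z] that by (simp add: g_def dist_norm)
  qed
  have "g holomorphic_on ball 0 (1/s)"
  proof -
    have "(F \<circ> (\<lambda>z. of_real s * z)) holomorphic_on ball 0 (1/s)"
      by (rule holomorphic_on_compose_gen[OF _ assms(2)])
        (use s in \<open>auto intro!: holomorphic_intros simp: norm_mult field_simps\<close>)
    then show ?thesis by (simp add: g_def[abs_def] o_def)
  qed
  note series = holomorphic_power_series[OF this]
  define a where "a n = (deriv ^^ n) g 0 / fact n" for n
  \<comment> \<open>Convergence at a point strictly between 1 and \<open>1 / s\<close> gives
    absolute summability of the coefficients.\<close>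
  define q where "q = (1 + 1/s) / 2"
  have q: "1 < q" "q < 1/s" using s by (auto simp: q_def field_simps)
  have "summable (\<lambda>n. a n * of_real q ^ n)"
    using series[of "of_real q"] q unfolding a_def by (auto simp: sums_iff)
  from powser_insidea[OF this, of 1] have sum: "summable (\<lambda>n. cmod (a n))"
    using q by simp
  have "uniform_limit (cball 0 1) (\<lambda>n z. \<Sum>k<n. a k * z ^ k) (\<lambda>z. \<Sum>k. a k * z ^ k) sequentially"
  proof (rule Weierstrass_m_test[OF _ sum])
    show "cmod (a n * z ^ n) \<le> cmod (a n)" if "z \<in> cball 0 1" for n z
      using that by (simp add: norm_mult norm_power mult_left_le power_le_one)
  qed
  from uniform_limitD[OF this, of "e/2"] assms(3)
  obtain N where "\<forall>z\<in>cball 0 1. dist (\<Sum>k<N. a k * z ^ k) (\<Sum>k. a k * z ^ k) < e/2"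
    by (auto simp: eventually_sequentially)
  moreover have "(\<Sum>k. a k * z ^ k) = g z" if "z \<in> cball 0 1" for z
  proof -
    have "z \<in> ball 0 (1/s)" using that q by auto
    then show ?thesis using series[of z] by (simp add: a_def sums_iff)
  qed
  ultimately have N: "cmod ((\<Sum>k<N. a k * z ^ k) - g z) < e/2" if "z \<in> cball 0 1" for z
    using that by (simp add: dist_norm)
  define p where "p = (\<Sum>k<N. monom (a k) k)"
  have "poly p z = (\<Sum>k<N. a k * z ^ k)" for z by (simp add: p_def poly_sum poly_monom)
  then have "cmod (F z - poly p z) < e" if "z \<in> cball 0 1" for z
    using near[OF that] N[OF that] norm_triangle_ineq4[of "F z - g z" "poly p z - g z"] by simp
  then show ?thesis using that by blast
qed

text \<open>The inversion u = r / (z - c) carries the exterior to the punctured disc, and decay at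
  infinity removes the singularity at u = 0. Then \<open>disc_poly_approx\<close> applies.\<close>

lemma exterior_poly_approx:
  assumes "continuous_on (- ball c r) G" "G holomorphic_on - cball c r" "0 < r" "0 < e"
    and lim: "(G \<longlongrightarrow> 0) at_infinity"
  obtains p where "\<And>z. z \<notin> ball c r \<Longrightarrow> cmod (G z - poly p (of_real r / (z - c))) < e"
proof -
  define H where "H u = (if u = 0 then 0 else G (c + of_real r / u))" for u
  have out: "\<not> cmod (of_real r / u) < r" if "u \<in> cball 0 1" "u \<noteq> 0" for u :: complex
    using that assms(3) by (simp add: norm_divide divide_simps)
  have out': "\<not> cmod (of_real r / u) \<le> r" if "u \<in> ball 0 1" "u \<noteq> 0" for u :: complex
    using that assms(3) by (simp add: norm_divide divide_simps)
  have "(H \<longlongrightarrow> 0) (at 0)"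
  proof -
    have "filterlim (\<lambda>u. of_real r / u) at_infinity (at (0::complex))"
      using assms(3) by (intro filterlim_divide_at_infinity tendsto_const filterlim_ident) auto
    then have "filterlim (\<lambda>u. c + of_real r / u) at_infinity (at 0)"
      by (intro tendsto_add_filterlim_at_infinity[OF tendsto_const])
    from filterlim_compose[OF lim this] show ?thesis
      by (rule Lim_transform_eventually) (auto simp: H_def eventually_at_filter)
  qed
  from tendsto_within_subset[OF this] have H0: "(H \<longlongrightarrow> H 0) (at 0 within S)" for S
    by (simp add: H_def)
  have contH: "continuous_on (cball 0 1) H"
  proof -
    have "continuous_on (cball 0 1 - {0}) (\<lambda>u. G (c + of_real r / u))"
      by (rule continuous_on_compose2[OF assms(1)])
        (use out in \<open>auto intro!: continuous_intros simp: dist_norm\<close>)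
    then have "continuous_on (cball 0 1 - {0}) H"
      by (rule continuous_on_eq) (auto simp: H_def)
    then have "(H \<longlongrightarrow> H u) (at u within cball 0 1 - {0})" if "u \<in> cball 0 1" "u \<noteq> 0" for u
      using that by (auto simp: continuous_on_def)
    moreover have "at u within cball 0 1 - {0} = at u within cball 0 1" if "u \<noteq> 0" for u :: complex
      using that by (intro at_within_nhd[of _ "- {0}"]) auto
    ultimately show ?thesis
      unfolding continuous_on_def using H0 by metis
  qed
  have "(\<lambda>u. G (c + of_real r / u)) holomorphic_on ball 0 1 - {0}"
  proof -
    have "(G \<circ> (\<lambda>u. c + of_real r / u)) holomorphic_on ball 0 1 - {0}"
      by (rule holomorphic_on_compose_gen[OF _ assms(2)])
        (use out' in \<open>auto intro!: holomorphic_intros simp: dist_norm\<close>)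
    then show ?thesis by (simp add: o_def)
  qed
  then have "H holomorphic_on ball 0 1 - {0}"
    by (rule holomorphic_transform) (auto simp: H_def)
  then have "H holomorphic_on ball 0 1"
    by (rule no_isolated_singularity'[rotated]) (use H0 in auto)
  then obtain p where p: "\<And>z. z \<in> cball 0 1 \<Longrightarrow> cmod (H z - poly p z) < e"
    using disc_poly_approx[OF contH _ assms(4)] by blast
  have "cmod (G z - poly p (of_real r / (z - c))) < e" if "z \<notin> ball c r" for z
  proof -
    have z: "r \<le> cmod (z - c)" using that by (simp add: dist_norm norm_minus_commute)
    then have "of_real r / (z - c) \<in> cball 0 1" "z \<noteq> c"
      using assms(3) by (auto simp: norm_divide divide_simps)
    moreover have "H (of_real r / (z - c)) = G z"
      using assms(3) \<open>z \<noteq> c\<close> by (simp add: H_def)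
    ultimately show ?thesis using p[of "of_real r / (z - c)"] by simp
  qed
  then show ?thesis using that by blast
qed

lemma cauchy_int_tendsto_0:
  assumes "continuous_on (sphere c r) f" "0 < r"
  shows "(cauchy_int c r f \<longlongrightarrow> 0) at_infinity"
proof -
  have "compact (f ` sphere c r)" using assms by (intro compact_continuous_image) auto
  then obtain M where "0 < M" "\<And>u. u \<in> sphere c r \<Longrightarrow> cmod (f u) \<le> M"
    using compact_imp_bounded bounded_pos by (metis image_eqI)
  then have M: "0 \<le> M" "\<And>u. cmod (u - c) = r \<Longrightarrow> cmod (f u) \<le> M"
    by (auto simp: dist_norm norm_minus_commute)
  have top: "filterlim (\<lambda>z. cmod (z - c) - r) at_top at_infinity"
  proof -
    have "filterlim (\<lambda>z. - (cmod c + r) + cmod z) at_top at_infinity"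
      by (intro filterlim_tendsto_add_at_top[OF tendsto_const] filterlim_norm_at_top)
    then show ?thesis
      by (rule filterlim_at_top_mono) (auto intro!: always_eventually simp: algebra_simps norm_triangle_sub)
  qed
  have "((\<lambda>z. M * r / (cmod (z - c) - r)) \<longlongrightarrow> 0) at_infinity"
    by (rule real_tendsto_divide_at_top[OF tendsto_const top])
  moreover have "eventually (\<lambda>z. 0 < cmod (z - c) - r) at_infinity"
    using filterlim_at_top_dense[THEN iffD1, OF top] by blast
  then have "eventually (\<lambda>z. cmod (cauchy_int c r f z) \<le> M * r / (cmod (z - c) - r)) at_infinity"
    by eventually_elim (use assms M in \<open>auto intro!: cauchy_int_bound\<close>)
  ultimately show ?thesis by (rule Lim_null_comparison[rotated])
qed

section \<open>Rational functions and their uniform limits\<close>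

lemma rational_without_poles_const: "rational_without_poles_on K (\<lambda>_. a)"
  unfolding rational_without_poles_on_def by (intro exI[of _ "[:a:]"] exI[of _ 1]) auto

lemma rational_without_poles_poly: "rational_without_poles_on K (poly p)"
  unfolding rational_without_poles_on_def by (intro exI[of _ p] exI[of _ 1]) auto

lemma rational_without_poles_inverse:
  assumes "c \<notin> K"
  shows "rational_without_poles_on K (\<lambda>z. a / (z - c))"
  unfolding rational_without_poles_on_def
  by (intro exI[of _ "[:a:]"] exI[of _ "[:-c, 1:]"]) (use assms in auto)

lemma rational_without_poles_add:
  assumes "rational_without_poles_on K f" "rational_without_poles_on K g"
  shows "rational_without_poles_on K (\<lambda>z. f z + g z)"
proof -
  obtain p q p' q' where "q \<noteq> 0" "q' \<noteq> 0"
    "\<forall>z\<in>K. poly q z \<noteq> 0 \<and> f z = poly p z / poly q z" "\<forall>z\<in>K. poly q' z \<noteq> 0 \<and> g z = poly p' z / poly q' z"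
    using assms unfolding rational_without_poles_on_def by blast
  then show ?thesis
    unfolding rational_without_poles_on_def
    by (intro exI[of _ "p * q' + p' * q"] exI[of _ "q * q'"]) (auto simp: add_frac_eq)
qed

lemma rational_without_poles_mult:
  assumes "rational_without_poles_on K f" "rational_without_poles_on K g"
  shows "rational_without_poles_on K (\<lambda>z. f z * g z)"
proof -
  obtain p q p' q' where "q \<noteq> 0" "q' \<noteq> 0"
    "\<forall>z\<in>K. poly q z \<noteq> 0 \<and> f z = poly p z / poly q z" "\<forall>z\<in>K. poly q' z \<noteq> 0 \<and> g z = poly p' z / poly q' z"
    using assms unfolding rational_without_poles_on_def by blast
  then show ?thesis
    unfolding rational_without_poles_on_def
    by (intro exI[of _ "p * p'"] exI[of _ "q * q'"]) auto
qed

lemma rational_without_poles_sum: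
  assumes "\<And>i. i \<in> I \<Longrightarrow> rational_without_poles_on K (f i)"
  shows "rational_without_poles_on K (\<lambda>z. \<Sum>i\<in>I. f i z)"
  using assms
  by (induction I rule: infinite_finite_induct)
    (auto intro!: rational_without_poles_const rational_without_poles_add)

lemma rational_without_poles_poly_compose:
  assumes "rational_without_poles_on K f"
  shows "rational_without_poles_on K (\<lambda>z. poly p (f z))"
proof (induction p)
  case 0
  then show ?case using rational_without_poles_const[of K 0] by simp
next
  case (pCons a p)
  then show ?case
    using rational_without_poles_add[OF rational_without_poles_const[of K a] rational_without_poles_mult[OF assms pCons(2)]]
    by simp
qed

lemma R_alg_iff:
  "f \<in> R_alg K \<longleftrightarrow> (\<forall>e>0. \<exists>r. rational_without_poles_on K r \<and> (\<forall>z\<in>K. cmod (f z - r z) < e))"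
proof
  assume "f \<in> R_alg K"
  then obtain r where r: "\<And>n. rational_without_poles_on K (r n)" "uniform_limit K r f sequentially"
    by (auto simp: R_alg_def)
  show "\<forall>e>0. \<exists>r. rational_without_poles_on K r \<and> (\<forall>z\<in>K. cmod (f z - r z) < e)"
  proof (intro allI impI)
    fix e :: real assume "0 < e"
    from uniform_limitD[OF r(2) this] obtain n where "\<forall>z\<in>K. dist (r n z) (f z) < e"
      by (auto simp: eventually_sequentially)
    then show "\<exists>r. rational_without_poles_on K r \<and> (\<forall>z\<in>K. cmod (f z - r z) < e)"
      using r(1) by (intro exI[of _ "r n"]) (auto simp: dist_norm norm_minus_commute)
  qed
next
  assume *: "\<forall>e>0. \<exists>r. rational_without_poles_on K r \<and> (\<forall>z\<in>K. cmod (f z - r z) < e)"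
  have "\<exists>r. rational_without_poles_on K r \<and> (\<forall>z\<in>K. cmod (f z - r z) < inverse (real (Suc n)))" for n
    using * by (meson inverse_positive_iff_positive of_nat_0_less_iff zero_less_Suc)
  then obtain r where r: "\<And>n. rational_without_poles_on K (r n)"
    "\<And>n z. z \<in> K \<Longrightarrow> cmod (f z - r n z) < inverse (real (Suc n))"
    by metis
  have "uniform_limit K r f sequentially"
  proof (rule uniform_limitI)
    fix e :: real assume "0 < e"
    then have "eventually (\<lambda>n. inverse (real (Suc n)) < e) sequentially"
      using LIMSEQ_inverse_real_of_nat by (intro order_tendstoD(2)) auto
    then show "eventually (\<lambda>n. \<forall>z\<in>K. dist (r n z) (f z) < e) sequentially"
      by eventually_elim (metis r(2) dist_norm norm_minus_commute less_trans)
  qed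
  then show "f \<in> R_alg K" using r(1) by (auto simp: R_alg_def)
qed

lemma poly_holomorphic: "poly p holomorphic_on S" for p :: "complex poly"
  using poly_DERIV by (meson field_differentiable_at_within field_differentiable_def holomorphic_onI)

lemma R_alg_subset_A_alg: "R_alg K \<subseteq> A_alg K"
proof
  fix f assume "f \<in> R_alg K"
  then obtain r where r: "\<And>n. rational_without_poles_on K (r n)" "uniform_limit K r f sequentially"
    by (auto simp: R_alg_def)
  obtain p q where pq: "\<And>n z. z \<in> K \<Longrightarrow> poly (q n) z \<noteq> 0" "\<And>n z. z \<in> K \<Longrightarrow> r n z = poly (p n) z / poly (q n) z"
    using r(1) unfolding rational_without_poles_on_def by metis
  have "continuous_on K (r n)" for n
  proof -
    have "continuous_on K (\<lambda>z. poly (p n) z / poly (q n) z)"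
      using pq(1) by (intro continuous_intros) auto
    then show ?thesis by (rule continuous_on_eq) (use pq(2) in auto)
  qed
  then have cont: "continuous_on K f"
    using r(2) by (intro uniform_limit_theorem) auto
  have "f holomorphic_on interior K"
  proof (rule holomorphic_uniform_sequence)
    show "r n holomorphic_on interior K" for n
    proof -
      have "(\<lambda>z. poly (p n) z / poly (q n) z) holomorphic_on interior K"
        using pq(1) interior_subset[of K] by (intro holomorphic_on_divide poly_holomorphic) auto
      then show ?thesis by (rule holomorphic_transform) (use pq(2) interior_subset[of K] in auto)
    qed
    fix x assume "x \<in> interior K"
    then obtain d where "0 < d" "cball x d \<subseteq> interior K"
      using open_contains_cball_eq[OF open_interior] by blast
    then show "\<exists>d>0. cball x d \<subseteq> interior K \<and> uniform_limit (cball x d) r f sequentially"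
      using uniform_limit_on_subset[OF r(2)] interior_subset[of K] by blast
  qed auto
  then show "f \<in> A_alg K" using cont by (simp add: A_alg_def)
qed

section \<open>Dimension below one\<close>

lemma compact_cheese: "compact (cheese a)"
proof -
  have "closed (cheese a)" unfolding cheese_def by (intro closed_Diff open_UN ballI) auto
  then show ?thesis
    using compact_Int_closed[of "cball 0 1" "cheese a"] by (simp add: cheese_def Int_absorb1 Diff_subset)
qed

definition words_upto :: "nat \<Rightarrow> complex list set" where
  "words_upto n = (\<Union>m\<le>n. words m)"

text \<open>Words shorter than \<open>n\<close> stand for their holes, words of length \<open>n\<close> for a disc that contains all
  holes of the later generations in their cell.\<close>

definition inner_rad :: "complex \<Rightarrow> nat \<Rightarrow> complex list \<Rightarrow> real" where
  "inner_rad a n w = (if length w < n then rad a (length w) else 9/10 * cmod a ^ n)"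

text \<open>The radius of the circle that carries the Cauchy integral of a Laurent part. The factor
  1/10 stays below the clearance 1/5 of \<open>cen_sep_level\<close>; 19/20 lies between 9/10 and
  the full cell radius.\<close>

definition outer_rad :: "complex \<Rightarrow> nat \<Rightarrow> complex list \<Rightarrow> real" where
  "outer_rad a n w = (if length w < n then cmod a ^ length w / 10 else 19/20 * cmod a ^ n)"

lemma words_upto_iff: "w \<in> words_upto n \<longleftrightarrow> w \<in> lists digits \<and> length w \<le> n"
  by (auto simp: words_upto_def words_def)

lemma finite_words_upto [simp]: "finite (words_upto n)"
  by (simp add: words_upto_def)

lemma words_upto_eq: "words_upto n = {w \<in> words_upto n. length w < n} \<union> words n"
  by (auto simp: words_upto_iff words_def)

lemma disjoint_cball_dist:
  assumes "r + s < cmod (x - y)"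
  shows "cball x r \<inter> cball y s = {}"
proof -
  have "\<not> (cmod (x - z) \<le> r \<and> cmod (y - z) \<le> s)" for z
    using assms norm_triangle_ineq4[of "x - z" "y - z"] by auto
  then show ?thesis by (auto simp: dist_norm)
qed

lemma rad_less:
  assumes "a \<noteq> 0"
  shows "rad a n < cmod a ^ n / 10"
proof -
  have "0 < cmod a ^ n" using assms by simp
  then show ?thesis using rad_le[of a n] by linarith
qed

context
  fixes a :: complex and n :: nat
  assumes a: "cmod a \<le> 3/10" "a \<noteq> 0" and n: "0 < n"
begin

lemma scale_power_pos: "0 < cmod a ^ m"
  using a by simp

lemma inner_outer: "0 < inner_rad a n w" "inner_rad a n w < outer_rad a n w"
  using rad_pos[OF a(2)] rad_less[OF a(2)] scale_power_pos by (auto simp: inner_rad_def outer_rad_def)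

lemma outer_in_disc:
  assumes "w \<in> words_upto n"
  shows "cball (cen a w) (outer_rad a n w) \<subseteq> ball 0 1"
proof -
  have "cmod (cen a w) + outer_rad a n w < 1"
  proof (cases "w = []")
    case True
    then show ?thesis using n by (simp add: outer_rad_def)
  next
    case False
    have "outer_rad a n w \<le> cmod a ^ length w"
      using assms scale_power_pos[of "length w"] by (auto simp: outer_rad_def words_upto_iff)
    then show ?thesis using cen_nonempty_bounds(1)[OF a(1) _ False] assms by (auto simp: words_upto_iff)
  qed
  then show ?thesis
  proof (intro subsetI)
    fix z assume "z \<in> cball (cen a w) (outer_rad a n w)"
    then have "cmod (z - cen a w) \<le> outer_rad a n w" by (simp add: dist_norm norm_minus_commute)
    then show "z \<in> ball 0 1"
      using norm_triangle_sub[of z "cen a w"] \<open>cmod (cen a w) + outer_rad a n w < 1\<close> by simp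
  qed
qed

lemma outer_disjoint:
  assumes "v \<in> words_upto n" "w \<in> words_upto n" "v \<noteq> w"
  shows "cball (cen a v) (outer_rad a n v) \<inter> cball (cen a w) (outer_rad a n w) = {}"
proof -
  have *: "outer_rad a n v + outer_rad a n w < cmod (cen a v - cen a w)"
    if "v \<in> words_upto n" "w \<in> words_upto n" "v \<noteq> w" "length v \<le> length w" for v w
  proof (cases "length v < n")
    case True
    then show ?thesis
      using cen_sep_level[OF a, of v w] that scale_power_pos[of "length v"] scale_power_pos[of "length w"]
      by (auto simp: outer_rad_def words_upto_iff)
  next
    case False
    then have "v \<in> words n" "w \<in> words n" using that by (auto simp: words_upto_iff words_def)
    then show ?thesis
      using cen_sep_same[OF a, of v n w] that(3) scale_power_pos[of n] wordsD(2) by (auto simp: outer_rad_def)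
  qed
  show ?thesis
  proof (cases "length v \<le> length w")
    case True
    then show ?thesis using *[OF assms] by (intro disjoint_cball_dist) auto
  next
    case False
    then show ?thesis using *[OF assms(2,1)] assms(3) by (subst Int_commute) (intro disjoint_cball_dist, auto)
  qed
qed

text \<open>A hole of generation at least \<open>n\<close> belongs to the cell of its prefix of
  length \<open>n\<close>. In units of that cell it is either the central hole or inside a proper
  subcell, hence within 9/10 of the centre.\<close>

lemma truncated_subset_cheese:
  "cball 0 1 - (\<Union>w\<in>words_upto n. ball (cen a w) (inner_rad a n w)) \<subseteq> cheese a"
proof -
  have "\<exists>w\<in>words_upto n. ball (cen a v) (rad a (length v)) \<subseteq> ball (cen a w) (inner_rad a n w)" if "v \<in> lists digits" for v
  proof (cases "length v < n")
    case True
    then show ?thesis using that by (intro bexI[of _ v]) (auto simp: inner_rad_def words_upto_iff)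
  next
    case False
    define w u where "w = take n v" and "u = drop n v"
    have w: "w \<in> lists digits" "u \<in> lists digits" "length w = n" "v = w @ u"
      using that False by (auto simp: w_def u_def dest: in_set_takeD in_set_dropD)
    have "cmod (cen a u) + cmod a ^ length u / 20 \<le> 9/10"
    proof (cases "u = []")
      case False
      then show ?thesis using cen_nonempty_bounds(1)[OF a(1) w(2)] scale_power_pos[of "length u"] by simp
    qed simp
    then have "cmod a ^ n * (cmod (cen a u) + cmod a ^ length u / 20) \<le> cmod a ^ n * (9/10)"
      by (intro mult_left_mono) auto
    then have "cmod (cen a v - cen a w) + cmod a ^ length v / 20 \<le> 9/10 * cmod a ^ n"
      using w by (simp add: cen_append norm_mult norm_power power_add algebra_simps)
    then have "cmod (cen a v - cen a w) + rad a (length v) \<le> 9/10 * cmod a ^ n"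
      using rad_le[of a "length v"] by linarith
    moreover have "ball (cen a v) (rad a (length v)) \<subseteq> ball (cen a w) (cmod (cen a v - cen a w) + rad a (length v))"
    proof
      fix z assume "z \<in> ball (cen a v) (rad a (length v))"
      then show "z \<in> ball (cen a w) (cmod (cen a v - cen a w) + rad a (length v))"
        using norm_triangle_ineq[of "cen a w - cen a v" "cen a v - z"] by (simp add: dist_norm norm_minus_commute)
    qed
    moreover have "inner_rad a n w = 9/10 * cmod a ^ n" by (simp add: inner_rad_def w(3))
    ultimately have "ball (cen a v) (rad a (length v)) \<subseteq> ball (cen a w) (inner_rad a n w)"
      by (metis order_trans subset_ball)
    then show ?thesis using w by (intro bexI[of _ w]) (auto simp: words_upto_iff)
  qed
  then show ?thesis unfolding cheese_def by blast
qed

text \<open>The outer tenth of a cell of generation \<open>n\<close> meets none of the removed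
  discs. Its rim supplies a reference point for \<open>f\<close> and the circle for the maximum
  principle.\<close>

lemma annulus_subset_truncated:
  assumes "w \<in> words n" "9/10 * cmod a ^ n \<le> cmod (u - cen a w)" "cmod (u - cen a w) \<le> cmod a ^ n"
  shows "u \<in> cball 0 1 - (\<Union>v\<in>words_upto n. ball (cen a v) (inner_rad a n v))"
    and "v \<in> words n \<Longrightarrow> v \<noteq> w \<Longrightarrow> cmod a ^ n \<le> cmod (u - cen a v)"
proof -
  have 1: "cmod a ^ n \<le> cmod (u - cen a v)" if "v \<in> words n" "v \<noteq> w" for v
    using cen_sep_same[OF a that(1) assms(1) that(2)] assms(3)
      norm_triangle_ineq4[of "u - cen a w" "u - cen a v"] by simp
  then show "v \<in> words n \<Longrightarrow> v \<noteq> w \<Longrightarrow> cmod a ^ n \<le> cmod (u - cen a v)" .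
  have "inner_rad a n v \<le> cmod (u - cen a v)" if v: "v \<in> words_upto n" for v
  proof (cases "length v < n")
    case True
    have "cmod a ^ length v / 5 + cmod a ^ n < cmod (cen a v - cen a w)"
      by (rule cen_sep_level[OF a, of v w, unfolded wordsD(2)[OF assms(1)]])
        (use v wordsD[OF assms(1)] True in \<open>auto simp: words_upto_iff\<close>)
    then have "cmod a ^ length v / 5 < cmod (u - cen a v)"
      using assms(3) norm_triangle_ineq4[of "u - cen a w" "u - cen a v"] by simp
    then show ?thesis
      using True rad_less[OF a(2), of "length v"] scale_power_pos[of "length v"] by (simp add: inner_rad_def)
  next
    case False
    then have "v \<in> words n" using v by (auto simp: words_upto_iff words_def)
    then show ?thesis
      using 1[of v] assms(2) False scale_power_pos[of n] by (cases "v = w") (auto simp: inner_rad_def)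
  qed
  moreover have "cmod u \<le> 1"
    using cen_bound[OF a(1) wordsD(1)[OF assms(1)]] wordsD(2)[OF assms(1)] assms(3)
      norm_triangle_sub[of u "cen a w"] by simp
  ultimately show "u \<in> cball 0 1 - (\<Union>v\<in>words_upto n. ball (cen a v) (inner_rad a n v))"
    by (force simp: dist_norm norm_minus_commute)
qed

end

text \<open>\<open>F\<close> is replaced by a polynomial in \<open>z\<close> and each
  \<open>G i\<close> by one in \<open>r i / (z - c i)\<close>, with its only pole in the hole; the
  error is shared equally among the \<open>card I + 1\<close> summands.\<close>

lemma rational_approx_circle_domain:
  assumes "finite I" "continuous_on (cball 0 1) F" "F holomorphic_on ball 0 1"
    and r: "\<And>i. i \<in> I \<Longrightarrow> 0 < r i"
    and G: "\<And>i. i \<in> I \<Longrightarrow> continuous_on (- ball (c i) (r i)) (G i)"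
      "\<And>i. i \<in> I \<Longrightarrow> G i holomorphic_on - cball (c i) (r i)"
      "\<And>i. i \<in> I \<Longrightarrow> (G i \<longlongrightarrow> 0) at_infinity"
    and K: "K \<subseteq> cball 0 1 - (\<Union>i\<in>I. ball (c i) (r i))" and "0 < e"
  obtains R where "rational_without_poles_on K R"
    "\<And>z. z \<in> K \<Longrightarrow> cmod (F z + (\<Sum>i\<in>I. G i z) - R z) < e"
proof -
  define h where "h = e / (real (card I) + 1)"
  have h: "0 < h" using assms(9) by (simp add: h_def add_nonneg_pos)
  obtain p where p: "\<And>z. z \<in> cball 0 1 \<Longrightarrow> cmod (F z - poly p z) < h"
    using disc_poly_approx[OF assms(2,3) h] by blast
  have "\<exists>p. \<forall>z. z \<notin> ball (c i) (r i) \<longrightarrow> cmod (G i z - poly p (of_real (r i) / (z - c i))) < h" if "i \<in> I" for i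
    using exterior_poly_approx[OF G(1,2)[OF that] r[OF that] h G(3)[OF that]] by blast
  then obtain P where P: "\<And>i z. i \<in> I \<Longrightarrow> z \<notin> ball (c i) (r i) \<Longrightarrow>
      cmod (G i z - poly (P i) (of_real (r i) / (z - c i))) < h" by metis
  define R where "R z = poly p z + (\<Sum>i\<in>I. poly (P i) (of_real (r i) / (z - c i)))" for z
  show ?thesis
  proof (rule that[of R])
    have "c i \<notin> K" if "i \<in> I" for i
    proof -
      have "c i \<in> ball (c i) (r i)" using r[OF that] by simp
      then show ?thesis using K that by blast
    qed
    then show "rational_without_poles_on K R"
      unfolding R_def
      by (intro rational_without_poles_add rational_without_poles_poly rational_without_poles_sum
          rational_without_poles_poly_compose rational_without_poles_inverse) auto
    fix z assume z: "z \<in> K"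
    have "F z + (\<Sum>i\<in>I. G i z) - R z = (F z - poly p z) + (\<Sum>i\<in>I. G i z - poly (P i) (of_real (r i) / (z - c i)))"
      by (simp add: R_def sum_subtractf)
    also have "cmod \<dots> \<le> cmod (F z - poly p z) + (\<Sum>i\<in>I. cmod (G i z - poly (P i) (of_real (r i) / (z - c i))))"
      by (rule order_trans[OF norm_triangle_ineq add_left_mono[OF norm_sum]])
    also have "\<dots> < h + (\<Sum>i\<in>I. h)"
    proof (rule add_less_le_mono)
      show "cmod (F z - poly p z) < h" using p z K by auto
      have "z \<notin> ball (c i) (r i)" if "i \<in> I" for i using z K that by blast
      then show "(\<Sum>i\<in>I. cmod (G i z - poly (P i) (of_real (r i) / (z - c i)))) \<le> (\<Sum>i\<in>I. h)"
        by (intro sum_mono less_imp_le P)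
    qed
    also have "\<dots> = h * (real (card I) + 1)" by (simp add: algebra_simps)
    also have "\<dots> = e" using of_nat_0_le_iff[of "card I"] by (simp add: h_def add_nonneg_eq_0_iff)
    finally show "cmod (F z + (\<Sum>i\<in>I. G i z) - R z) < e" .
  qed
qed

lemma A_alg_cheese_approx:
  assumes "cmod a < 1/4" "a \<noteq> 0" "f \<in> A_alg (cheese a)" "0 < e"
  shows "\<exists>R. rational_without_poles_on (cheese a) R \<and> (\<forall>z\<in>cheese a. cmod (f z - R z) < e)"
proof -
  have a: "cmod a \<le> 3/10" "a \<noteq> 0" using assms by auto
  have f: "continuous_on (cheese a) f" "f holomorphic_on interior (cheese a)"
    using assms(3) by (auto simp: A_alg_def)
  \<comment> \<open>The bound of \<open>sum_words_bound\<close> for \<open>p = 1\<close>.\<close>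
  define C where "C = 1 + 10 / (1 - 4 * cmod a)"
  have C: "0 < C" using assms(1) by (auto simp: C_def intro!: add_pos_pos divide_pos_pos)
  \<comment> \<open>Chosen so that the bound \<open>(2 + 19 * C) * h\<close> of \<open>main\<close>
    equals \<open>e / 2\<close>; the other half is spent on rational approximation.\<close>
  define h where "h = e / (2 * (2 + 19 * C))"
  have h: "0 < h" using assms(4) C by (simp add: h_def)
  have "uniformly_continuous_on (cheese a) f"
    using f(1) compact_cheese by (rule compact_uniformly_continuous)
  then obtain d where d: "0 < d"
    "\<And>x y. x \<in> cheese a \<Longrightarrow> y \<in> cheese a \<Longrightarrow> dist y x < d \<Longrightarrow> dist (f y) (f x) < h"
    using h unfolding uniformly_continuous_on_def by metis
  have "(\<lambda>n. cmod a ^ n) \<longlonglongrightarrow> 0" using a by (intro LIMSEQ_power_zero) auto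
  then have "eventually (\<lambda>n. cmod a ^ n < d / 2) sequentially"
    using d(1) by (intro order_tendstoD(2)) auto
  then have "eventually (\<lambda>n. cmod a ^ n < d / 2 \<and> 0 < n) sequentially"
    using eventually_gt_at_top[of 0] by eventually_elim auto
  then obtain n where n: "cmod a ^ n < d / 2" "0 < n"
    by (auto simp: eventually_sequentially)
  note pos = scale_power_pos[OF a n(2), of n]
  define I where "I = words_upto n"
  define I0 where "I0 = {w \<in> I. length w < n}"
  define s where "s = inner_rad a n"
  define t where "t = outer_rad a n"
  define X where "X = cball 0 1 - (\<Union>w\<in>I. ball (cen a w) (s w))"
  have X: "X \<subseteq> cheese a"
    using truncated_subset_cheese[OF a n(2)] by (simp add: X_def I_def s_def)
  have s0: "s w = rad a (length w)" if "w \<in> I0" for w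
    using that by (simp add: I0_def s_def inner_rad_def)
  have sn: "s w = 9/10 * cmod a ^ n" "t w = 19/20 * cmod a ^ n" if "w \<in> words n" for w
    using wordsD(2)[OF that] by (simp_all add: s_def t_def inner_rad_def outer_rad_def)
  have I: "I = I0 \<union> words n" "I0 \<inter> words n = {}"
    using words_upto_eq[of n] by (auto simp: I_def I0_def wordsD)
  have V: "ball 0 1 - (\<Union>w\<in>I. cball (cen a w) (s w)) \<subseteq> interior (cheese a)"
  proof (rule interior_maximal)
    show "ball 0 1 - (\<Union>w\<in>I. cball (cen a w) (s w)) \<subseteq> cheese a"
      by (rule order_trans[OF _ X]) (auto simp: X_def)
    show "open (ball 0 1 - (\<Union>w\<in>I. cball (cen a w) (s w)))"
      by (intro open_Diff closed_UN ballI) (auto simp: I_def)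
  qed
  have "\<exists>F G. continuous_on (cball 0 1) F \<and> F holomorphic_on ball 0 1 \<and>
    (\<forall>w\<in>I. continuous_on (- ball (cen a w) (s w)) (G w) \<and> G w holomorphic_on - cball (cen a w) (s w) \<and>
      (\<forall>z. z \<notin> cball (cen a w) (t w) \<longrightarrow> G w z = - cauchy_int (cen a w) (t w) f z)) \<and>
    (\<forall>z\<in>cball 0 1 - (\<Union>w\<in>I. ball (cen a w) (s w)). f z = F z + (\<Sum>w\<in>I. G w z))"
  proof (rule circle_domain_split)
    show "f holomorphic_on ball 0 1 - (\<Union>w\<in>I. cball (cen a w) (s w))"
      using f(2) V by (rule holomorphic_on_subset)
    show "continuous_on (cball 0 1 - (\<Union>w\<in>I. ball (cen a w) (s w))) f"
      using f(1) X unfolding X_def by (rule continuous_on_subset)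
  qed (use inner_outer[OF a n(2)] outer_in_disc[OF a n(2)] outer_disjoint[OF a n(2)] in
      \<open>auto simp: I_def s_def t_def\<close>)
  then obtain F G where F: "continuous_on (cball 0 1) F" "F holomorphic_on ball 0 1"
    and G: "\<And>w. w \<in> I \<Longrightarrow> continuous_on (- ball (cen a w) (s w)) (G w)"
      "\<And>w. w \<in> I \<Longrightarrow> G w holomorphic_on - cball (cen a w) (s w)"
      "\<And>w z. w \<in> I \<Longrightarrow> z \<notin> cball (cen a w) (t w) \<Longrightarrow> G w z = - cauchy_int (cen a w) (t w) f z"
    and fFG: "\<And>z. z \<in> X \<Longrightarrow> f z = F z + (\<Sum>w\<in>I. G w z)"
    unfolding X_def by blast
  \<comment> \<open>The candidate that replaces \<open>f\<close>: the Laurent parts of generation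
    \<open>n\<close> are dropped, and those of the finitely many earlier holes are kept.\<close>
  define Fh where "Fh z = F z + (\<Sum>w\<in>I0. G w z)" for z
  have fFh: "f z = Fh z + (\<Sum>w\<in>words n. G w z)" if "z \<in> X" for z
  proof -
    have "(\<Sum>w\<in>I. G w z) = (\<Sum>w\<in>I0. G w z) + (\<Sum>w\<in>words n. G w z)"
      unfolding I(1) by (rule sum.union_disjoint) (auto simp: I0_def I_def I(2)[unfolded I0_def I_def])
    then show ?thesis using fFG[OF that] by (simp add: Fh_def)
  qed
  have sphX: "sphere (cen a w) (t w) \<subseteq> X" if w: "w \<in> I" for w
  proof
    fix u assume u: "u \<in> sphere (cen a w) (t w)"
    have "u \<notin> ball (cen a v) (s v)" if v: "v \<in> I" for v
    proof (cases "v = w")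
      case True
      then show ?thesis using u inner_outer(2)[OF a n(2), of w] by (simp add: s_def t_def)
    next
      case False
      then have "u \<notin> cball (cen a v) (t v)"
        using outer_disjoint[OF a n(2), of v w] u v w by (auto simp: I_def t_def)
      then show ?thesis using inner_outer(2)[OF a n(2), of v] by (simp add: s_def t_def)
    qed
    moreover have "u \<in> cball (cen a w) (outer_rad a n w)" using u by (simp add: t_def)
    then have "u \<in> ball 0 1" by (rule subsetD[OF outer_in_disc[OF a n(2) w[unfolded I_def]]])
    ultimately show "u \<in> X" by (auto simp: X_def)
  qed
  have Glim: "(G w \<longlongrightarrow> 0) at_infinity" if w: "w \<in> I" for w
  proof -
    have "continuous_on (sphere (cen a w) (t w)) f"
      using f(1) X sphX[OF w] continuous_on_subset by blast
    then have "((\<lambda>z. - cauchy_int (cen a w) (t w) f z) \<longlongrightarrow> - 0) at_infinity"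
      using inner_outer[OF a n(2), of w] by (intro tendsto_minus cauchy_int_tendsto_0) (auto simp: t_def)
    moreover have "eventually (\<lambda>z. - cauchy_int (cen a w) (t w) f z = G w z) at_infinity"
    proof -
      have "eventually (\<lambda>z. z \<notin> cball (cen a w) (t w)) at_infinity"
        unfolding eventually_at_infinity
      proof (intro exI[of _ "cmod (cen a w) + t w + 1"] allI impI notI)
        fix z assume z: "cmod (cen a w) + t w + 1 \<le> cmod z" "z \<in> cball (cen a w) (t w)"
        then have "cmod (z - cen a w) \<le> t w" by (simp add: dist_norm norm_minus_commute)
        then show False using z(1) norm_triangle_sub[of z "cen a w"] by simp
      qed
      then show ?thesis by eventually_elim (use G(3) w in simp)
    qed
    ultimately show ?thesis using Lim_transform_eventually by fastforce
  qed
  \<comment> \<open>The value of \<open>f\<close> at a point on the rim of the cell. Other points of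
    the cell are within \<open>2 * cmod a ^ n\<close> < \<open>d\<close> of it.\<close>
  define k where "k w = f (cen a w + of_real (cmod a ^ n))" for w
  have osc: "cmod (f u - k w) \<le> h" if w: "w \<in> words n" and u: "u \<in> cheese a" "cmod (u - cen a w) \<le> cmod a ^ n" for u w
  proof -
    define v where "v = cen a w + of_real (cmod a ^ n)"
    have v: "cmod (v - cen a w) = cmod a ^ n" by (simp add: v_def norm_power)
    then have "v \<in> X"
      using annulus_subset_truncated(1)[OF a n(2) w, of v] pos by (simp add: X_def I_def s_def)
    moreover have "dist u v < d"
      using norm_triangle_ineq4[of "u - cen a w" "v - cen a w"] u(2) v n(1) by (simp add: dist_norm)
    ultimately show ?thesis using d(2)[of v u] u(1) X by (auto simp: dist_norm k_def v_def)
  qed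
  have Gbound: "cmod (G w z) \<le> 19 * h * (1 / max 1 (cmod (z - cen a w) / cmod a ^ n))"
    if w: "w \<in> words n" and z: "cmod a ^ n \<le> cmod (z - cen a w)" for w z
  proof -
    have wI: "w \<in> I" using w I(1) by blast
    define x y where "x = cmod a ^ n" and "y = cmod (z - cen a w)"
    have xy: "0 < x" "x \<le> y" using pos z by (auto simp: x_def y_def)
    have tw: "t w = 19/20 * x" "0 < t w" using sn[OF w] xy by (auto simp: x_def)
    have zt: "t w < cmod (z - cen a w)" using tw xy by (simp flip: y_def)
    have out: "z \<notin> cball (cen a w) (t w)"
      using zt by (simp add: dist_norm norm_minus_commute)
    have contf: "continuous_on (sphere (cen a w) (t w)) f"
      using f(1) X sphX[OF wI] continuous_on_subset by blast
    \<comment> \<open>A constant has no Laurent part, so \<open>f\<close> may be replaced by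
      \<open>f - k w\<close>, which is bounded by the oscillation \<open>h\<close>.\<close>
    have "cauchy_int (cen a w) (t w) (\<lambda>u. f u + - k w) z = cauchy_int (cen a w) (t w) f z + cauchy_int (cen a w) (t w) (\<lambda>u. - k w) z"
      using contf tw(2) zt by (intro cauchy_int_add) auto
    also have "cauchy_int (cen a w) (t w) (\<lambda>u. - k w) z = 0"
      by (rule cauchy_int_outside[of _ UNIV]) (use out tw(2) in auto)
    finally have "G w z = - cauchy_int (cen a w) (t w) (\<lambda>u. f u + - k w) z"
      using G(3)[of w z] out w I(1) by simp
    also have "cmod \<dots> \<le> h * t w / (cmod (z - cen a w) - t w)"
      unfolding norm_minus_cancel
    proof (rule cauchy_int_bound)
      show "cmod (f u + - k w) \<le> h" if "cmod (u - cen a w) = t w" for u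
      proof -
        have "u \<in> cheese a" using that sphX[OF wI] X by (force simp: dist_norm norm_minus_commute)
        then show ?thesis using osc[OF w, of u] that tw xy by (simp add: x_def)
      qed
    qed (use contf tw(2) zt h in \<open>auto intro!: continuous_intros\<close>)
    also have "\<dots> \<le> 19 * h * (x / y)"
    proof -
      \<comment> \<open>Since \<open>t w\<close> is 19/20 of \<open>x\<close> and
        \<open>x \<le> y\<close>, the denominator is at least \<open>y / 20\<close>; hence
        19.\<close>
      have "t w / (y - t w) \<le> 19 * x / y"
        using xy by (simp add: tw divide_simps)
      from mult_left_mono[OF this, of h] show ?thesis using h by (simp add: y_def algebra_simps)
    qed
    also have "x / y = 1 / max 1 (y / x)" using xy by (simp add: max_def)
    finally show ?thesis by (simp only: x_def y_def)
  qed
  have Gsum: "cmod (\<Sum>w\<in>words n. G w z) \<le> 19 * h * C"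
    if z: "\<And>w. w \<in> words n \<Longrightarrow> cmod a ^ n \<le> cmod (z - cen a w)" for z
  proof -
    have "cmod (\<Sum>w\<in>words n. G w z) \<le> (\<Sum>w\<in>words n. 19 * h * (1 / max 1 (cmod (z - cen a w) / cmod a ^ n)))"
      using Gbound z by (intro sum_norm_le) auto
    also have "\<dots> = 19 * h * (\<Sum>w\<in>words n. (1 / max 1 (cmod (z - cen a w) / cmod a ^ n)) ^ 1)"
      by (simp only: sum_distrib_left power_one_right)
    also have "\<dots> \<le> 19 * h * C"
      using sum_words_bound[OF a, of 1 z n] assms(1) h by (intro mult_left_mono) (auto simp: C_def)
    finally show ?thesis .
  qed
  have main: "cmod (f z - Fh z) \<le> (2 + 19 * C) * h" if z: "z \<in> cheese a" for z
  proof (cases "\<exists>w\<in>words n. cmod (z - cen a w) < cmod a ^ n")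
    case False
    then have far: "cmod a ^ n \<le> cmod (z - cen a w)" if "w \<in> words n" for w using that by force
    have "z \<notin> ball (cen a w) (s w)" if "w \<in> I" for w
    proof (cases "w \<in> words n")
      case True
      then show ?thesis using far[OF True] sn[OF True] pos by (simp add: dist_norm norm_minus_commute)
    next
      case False
      then have "w \<in> I0" using that I by auto
      then show ?thesis using z s0 by (auto simp: cheese_def I0_def I_def words_upto_iff)
    qed
    then have "z \<in> X" using z by (auto simp: X_def cheese_def)
    then have "cmod (f z - Fh z) \<le> 19 * h * C" using fFh[of z] Gsum[of z] far by simp
    also have "\<dots> \<le> (2 + 19 * C) * h" using h by (simp add: algebra_simps)
    finally show ?thesis .
  next
    case True
    then obtain w where w: "w \<in> words n" "cmod (z - cen a w) < cmod a ^ n" by blast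
    \<comment> \<open>Inside a cell both \<open>f\<close> and \<open>Fh\<close> are compared with
      the constant \<open>k w\<close>. \<open>Fh\<close> is holomorphic on the whole closed cell, so
      the maximum principle moves its estimate to the rim, where \<open>Gsum\<close>
      applies.\<close>
    define B where "B = ball (cen a w) (cmod a ^ n)"
    have clB: "closure B = cball (cen a w) (cmod a ^ n)" "frontier B = sphere (cen a w) (cmod a ^ n)"
      using pos by (simp_all add: B_def)
    have Gv: "cball (cen a w) (cmod a ^ n) \<subseteq> - cball (cen a v) (s v)" if v: "v \<in> I0" for v
    proof -
      have "cmod a ^ length v / 5 + cmod a ^ n < cmod (cen a v - cen a w)"
        by (rule cen_sep_level[OF a, of v w, unfolded wordsD(2)[OF w(1)]])
          (use v wordsD[OF w(1)] in \<open>auto simp: I0_def I_def words_upto_iff\<close>)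
      moreover have "s v < cmod a ^ length v / 5"
        using s0[OF v] rad_less[OF a(2), of "length v"] scale_power_pos[OF a n(2), of "length v"] by simp
      ultimately have "cball (cen a v) (s v) \<inter> cball (cen a w) (cmod a ^ n) = {}"
        by (intro disjoint_cball_dist) simp
      then show ?thesis by blast
    qed
    have B1: "cball (cen a w) (cmod a ^ n) \<subseteq> ball 0 1"
    proof
      fix u assume "u \<in> cball (cen a w) (cmod a ^ n)"
      then have "cmod (u - cen a w) \<le> cmod a ^ n" by (simp add: dist_norm norm_minus_commute)
      moreover have "w \<noteq> []" using wordsD(2)[OF w(1)] n(2) by auto
      ultimately show "u \<in> ball 0 1"
        using cen_nonempty_bounds(1)[OF a(1) wordsD(1)[OF w(1)]] wordsD(2)[OF w(1)]
          norm_triangle_sub[of u "cen a w"] by simp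
    qed
    have hol: "Fh holomorphic_on cball (cen a w) (cmod a ^ n)"
      unfolding Fh_def using F(2) B1 G(2) Gv I(1)
      by (intro holomorphic_intros) (blast intro: holomorphic_on_subset)+
    have "cmod (Fh z - k w) \<le> h + 19 * h * C"
    proof (rule maximum_modulus_frontier[of "\<lambda>z. Fh z - k w" B])
      show "(\<lambda>z. Fh z - k w) holomorphic_on interior B"
        using hol by (intro holomorphic_intros) (auto simp: B_def elim!: holomorphic_on_subset)
      show "continuous_on (closure B) (\<lambda>z. Fh z - k w)"
        unfolding clB using holomorphic_on_imp_continuous_on[OF hol] by (intro continuous_intros)
      show "bounded B" "z \<in> B"
        using w(2) by (auto simp: B_def dist_norm norm_minus_commute)
      fix u assume "u \<in> frontier B"
      then have u: "cmod (u - cen a w) = cmod a ^ n" by (simp add: clB dist_norm norm_minus_commute)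
      note ann = annulus_subset_truncated[OF a n(2) w(1), of u]
      have uX: "u \<in> X" using ann(1) u pos by (simp add: X_def I_def s_def)
      have "cmod a ^ n \<le> cmod (u - cen a v)" if "v \<in> words n" for v
        using ann(2)[of v] that u pos by (cases "v = w") auto
      then have "cmod (\<Sum>w\<in>words n. G w u) \<le> 19 * h * C" by (rule Gsum)
      moreover have "cmod (f u - k w) \<le> h" using osc[OF w(1), of u] uX X u by auto
      moreover have eq: "Fh u - k w = (f u - k w) - (\<Sum>w\<in>words n. G w u)" using fFh[OF uX] by simp
      have "cmod (Fh u - k w) \<le> cmod (f u - k w) + cmod (\<Sum>w\<in>words n. G w u)"
        unfolding eq by (rule norm_triangle_ineq4)
      ultimately show "cmod (Fh u - k w) \<le> h + 19 * h * C" by linarith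
    qed
    moreover have "cmod (f z - k w) \<le> h" using osc[OF w(1) z] w(2) by simp
    moreover have "cmod (f z - Fh z) \<le> cmod (f z - k w) + cmod (Fh z - k w)"
      using norm_triangle_ineq4[of "f z - k w" "Fh z - k w"] by simp
    ultimately show ?thesis by (simp add: algebra_simps)
  qed
  have err: "(2 + 19 * C) * h = e / 2" using C by (simp add: h_def field_simps)
  have sub: "cheese a \<subseteq> cball 0 1 - (\<Union>w\<in>I0. ball (cen a w) (s w))"
    using s0 by (auto simp: cheese_def I0_def I_def words_upto_iff)
  have I0: "finite I0" "\<And>w. w \<in> I0 \<Longrightarrow> w \<in> I" "\<And>w. 0 < s w"
    using inner_outer(1)[OF a n(2)] by (auto simp: I0_def I_def s_def)
  obtain R where R: "rational_without_poles_on (cheese a) R"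
    "\<And>z. z \<in> cheese a \<Longrightarrow> cmod (F z + (\<Sum>w\<in>I0. G w z) - R z) < e / 2"
    by (rule rational_approx_circle_domain[OF I0(1) F I0(3) G(1,2)[OF I0(2)] Glim[OF I0(2)] sub, of "e / 2"])
      (use assms(4) in simp_all)
  have "cmod (f z - R z) < e" if "z \<in> cheese a" for z
    using main[OF that] R(2)[OF that] err norm_triangle_ineq[of "f z - Fh z" "Fh z - R z"]
    by (simp add: Fh_def)
  then show ?thesis using R(1) by (intro exI[of _ R]) simp
qed

theorem R_alg_cheese_eq_A_alg:
  assumes "cmod a < 1/4" "a \<noteq> 0"
  shows "R_alg (cheese a) = A_alg (cheese a)"
proof (intro equalityI R_alg_subset_A_alg subsetI)
  fix f assume "f \<in> A_alg (cheese a)"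
  then show "f \<in> R_alg (cheese a)"
    unfolding R_alg_iff using A_alg_cheese_approx[OF assms] by blast
qed

section \<open>Dimension above one\<close>

text \<open>\<open>kernel\<close> is the Cauchy transform of the uniform unit mass on the unit disc, and \<open>charge a n\<close> that of
  the unit mass spread evenly over the cells of generation \<open>n\<close>.\<close>

definition kernel :: "complex \<Rightarrow> complex" where
  "kernel u = (if 1 \<le> cmod u then 1 / u else cnj u)"

definition charge :: "complex \<Rightarrow> nat \<Rightarrow> complex \<Rightarrow> complex" where
  "charge a n z = (\<Sum>w\<in>words n. kernel ((z - cen a w) / a ^ n)) / (4 * a) ^ n"

definition cells :: "complex \<Rightarrow> nat \<Rightarrow> complex set" where
  "cells a n = (\<Union>w\<in>words n. cball (cen a w) (cmod a ^ n))"

section \<open>Refinement of the kernel and convergence of the charges\<close>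

lemma kernel_bound: "cmod (kernel u) \<le> 1"
  by (auto simp: kernel_def norm_divide divide_le_eq_1)

lemma continuous_on_kernel: "continuous_on UNIV kernel"
proof -
  have "continuous_on ({u. 1 \<le> cmod u} \<union> {u. cmod u \<le> 1}) kernel"
  proof (rule continuous_on_closed_Un)
    have "continuous_on {u. 1 \<le> cmod u} (\<lambda>u. 1 / u)"
      by (intro continuous_intros) auto
    then show "continuous_on {u. 1 \<le> cmod u} kernel"
      by (rule continuous_on_eq) (simp add: kernel_def)
    have "continuous_on {u. cmod u \<le> 1} cnj" by (intro continuous_intros)
    then show "continuous_on {u. cmod u \<le> 1} kernel"
    proof (rule continuous_on_eq)
      fix u :: complex assume u: "u \<in> {u. cmod u \<le> 1}"
      have "cnj u = 1 / u" if "cmod u = 1"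
      proof -
        have "u * cnj u = 1" using that complex_norm_square[of u] by simp
        then show ?thesis by (metis mult_eq_0_iff nonzero_mult_div_cancel_left one_neq_zero)
      qed
      then show "cnj u = kernel u" using u by (auto simp: kernel_def)
    qed
  qed (auto intro!: closed_Collect_le continuous_intros)
  moreover have "{u. 1 \<le> cmod u} \<union> {u. cmod u \<le> 1} = UNIV" by auto
  ultimately show ?thesis by simp
qed

context
  fixes a :: complex
  assumes a: "cmod a \<le> 3/10" "1/4 < cmod a"
begin

lemma scale_nz: "a \<noteq> 0"
  using a by auto

text \<open>Passing from a disc to its four children preserves the total mass, so for |u| >= 1 the
  terms of order 1/u cancel and a remainder of order 1/|u|^2 is left. For |u| < 1 the bound is 4 + 1
  = 5, since \<open>4 * cmod a\<close> > 1.\<close>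

lemma kernel_refine_bound:
  "cmod ((\<Sum>t\<in>digits. kernel ((u - t) / a)) / (4 * a) - kernel u) \<le> 5 * (1 / max 1 (cmod u)) ^ 2"
proof (cases "1 \<le> cmod u")
  case False
  have "cmod (\<Sum>t\<in>digits. kernel ((u - t) / a)) \<le> (\<Sum>t\<in>digits. 1)"
    by (rule sum_norm_le) (rule kernel_bound)
  then have "cmod ((\<Sum>t\<in>digits. kernel ((u - t) / a)) / (4 * a)) \<le> 4 / (4 * (1/4))"
    unfolding norm_divide using a by (intro frac_le) (auto simp: card_digits norm_mult)
  then have "cmod ((\<Sum>t\<in>digits. kernel ((u - t) / a)) / (4 * a) - kernel u) \<le> 4 + 1"
    using norm_triangle_ineq4[of "(\<Sum>t\<in>digits. kernel ((u - t) / a)) / (4 * a)" "kernel u"] kernel_bound[of u] by simp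
  then show ?thesis using False by simp
next
  case True
  have u0: "u \<noteq> 0" using True by auto
  have dist: "2/5 * cmod u \<le> cmod (u - t)" if "t \<in> digits" for t
    using norm_triangle_ineq2[of u t] norm_digit[OF that] True by simp
  have summand: "kernel ((u - t) / a) / (4 * a) - kernel u / 4 = t / (4 * u * (u - t))" if "t \<in> digits" for t
  proof -
    have "u - t \<noteq> 0" using dist[OF that] True by auto
    moreover have "1 \<le> cmod ((u - t) / a)"
      unfolding norm_divide using dist[OF that] True a scale_nz by (simp add: divide_simps)
    ultimately show ?thesis using True scale_nz u0 by (simp add: kernel_def field_simps)
  qed
  have "(\<Sum>t\<in>digits. kernel ((u - t) / a)) / (4 * a) - kernel u
      = (\<Sum>t\<in>digits. kernel ((u - t) / a) / (4 * a) - kernel u / 4)"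
    by (simp add: sum_subtractf sum_divide_distrib card_digits)
  also have "cmod \<dots> \<le> (\<Sum>t\<in>digits. 1 / (cmod u) ^ 2)"
  proof (rule sum_norm_le)
    fix t assume t: "t \<in> digits"
    have "cmod (t / (4 * u * (u - t))) = (3/5) / (4 * cmod u * cmod (u - t))"
      unfolding norm_divide norm_mult norm_digit[OF t] by simp
    also have "\<dots> \<le> (3/5) / (4 * cmod u * (2/5 * cmod u))"
    proof (intro divide_left_mono mult_left_mono dist[OF t])
      have "0 < cmod (u - t)" using dist[OF t] True by linarith
      then show "0 < 4 * cmod u * cmod (u - t) * (4 * cmod u * (2/5 * cmod u))"
        using u0 by simp
    qed auto
    also have "\<dots> \<le> 1 / (cmod u) ^ 2"
      using u0 by (simp add: divide_simps power2_eq_square)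
    finally show "cmod (kernel ((u - t) / a) / (4 * a) - kernel u / 4) \<le> 1 / (cmod u) ^ 2"
      by (simp add: summand[OF t])
  qed
  also have "\<dots> \<le> 5 * (1 / max 1 (cmod u)) ^ 2"
    using True u0 by (simp add: card_digits power_divide max_def divide_right_mono)
  finally show ?thesis .
qed

text \<open>Refinement at the end of the words turns the difference into a sum of the quadratically
  decaying errors, bounded by \<open>sum_words_bound\<close> with \<open>p = 2\<close>. The
  normalisation by \<open>(4 * a) ^ n\<close> makes it geometrically small.\<close>

lemma charge_step: "cmod (charge a (Suc n) z - charge a n z) \<le> (5 * (1 + 100 / (1 - 4 * cmod a ^ 2))) * (1 / (4 * cmod a)) ^ n"
proof -
  define g where "g u = (\<Sum>t\<in>digits. kernel ((u - t) / a)) / (4 * a) - kernel u" for u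
  have "charge a (Suc n) z - charge a n z = (\<Sum>w\<in>words n. g ((z - cen a w) / a ^ n)) / (4 * a) ^ n"
  proof -
    have "kernel ((z - cen a (w @ [t])) / a ^ Suc n) = kernel (((z - cen a w) / a ^ n - t) / a)" if "w \<in> words n" for w t
      using scale_nz wordsD(2)[OF that] by (simp add: cen_append field_simps)
    then have "charge a (Suc n) z = (\<Sum>w\<in>words n. \<Sum>t\<in>digits. kernel (((z - cen a w) / a ^ n - t) / a)) / (4 * a) ^ Suc n"
      by (simp add: charge_def sum_words_Suc_end del: power_Suc)
    also have "\<dots> = (\<Sum>w\<in>words n. (\<Sum>t\<in>digits. kernel (((z - cen a w) / a ^ n - t) / a)) / (4 * a)) / (4 * a) ^ n"
      by (simp add: sum_divide_distrib mult.commute)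
    finally show ?thesis
      by (simp add: charge_def g_def sum_subtractf diff_divide_distrib)
  qed
  also have "cmod \<dots> = cmod (\<Sum>w\<in>words n. g ((z - cen a w) / a ^ n)) * (1 / (4 * cmod a)) ^ n"
    by (simp add: norm_divide norm_power norm_mult power_divide)
  also have "cmod (\<Sum>w\<in>words n. g ((z - cen a w) / a ^ n)) \<le> 5 * (1 + 100 / (1 - 4 * cmod a ^ 2))"
  proof -
    have "cmod (\<Sum>w\<in>words n. g ((z - cen a w) / a ^ n))
        \<le> (\<Sum>w\<in>words n. 5 * (1 / max 1 (cmod (z - cen a w) / cmod a ^ n)) ^ 2)"
    proof (rule sum_norm_le)
      show "cmod (g ((z - cen a w) / a ^ n)) \<le> 5 * (1 / max 1 (cmod (z - cen a w) / cmod a ^ n)) ^ 2" for w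
        using kernel_refine_bound[of "(z - cen a w) / a ^ n"] by (simp add: g_def norm_divide norm_power)
    qed
    also have "\<dots> = 5 * (\<Sum>w\<in>words n. (1 / max 1 (cmod (z - cen a w) / cmod a ^ n)) ^ 2)"
      by (simp only: sum_distrib_left)
    also have "\<dots> \<le> 5 * (1 + 10 ^ 2 / (1 - 4 * cmod a ^ 2))"
    proof (intro mult_left_mono sum_words_bound[OF a(1) scale_nz])
      have "cmod a ^ 2 \<le> (3/10) ^ 2" using a(1) by (intro power_mono) auto
      then show "4 * cmod a ^ 2 < 1" by (simp add: power2_eq_square)
    qed auto
    finally show ?thesis by simp
  qed
  finally show ?thesis by (simp add: mult_right_mono)
qed

lemma continuous_on_charge: "continuous_on UNIV (charge a n)"
proof -
  have "continuous_on UNIV (\<lambda>z. kernel ((z - cen a w) / a ^ n))" for w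
    by (rule continuous_on_compose2[OF continuous_on_kernel]) (use scale_nz in \<open>auto intro!: continuous_intros\<close>)
  then show ?thesis unfolding charge_def using scale_nz by (intro continuous_intros) auto
qed

text \<open>Outside a disc its uniform mass acts as a point mass at the centre, so the scale
  \<open>a ^ n\<close> cancels.\<close>

lemma charge_off_cells:
  assumes "z \<notin> cells a n"
  shows "charge a n z = (\<Sum>w\<in>words n. 1 / (z - cen a w)) / 4 ^ n"
proof -
  have "kernel ((z - cen a w) / a ^ n) = a ^ n / (z - cen a w)" if "w \<in> words n" for w
  proof -
    have "cmod a ^ n < cmod (z - cen a w)"
      using assms that by (auto simp: cells_def dist_norm norm_minus_commute)
    then have "1 \<le> cmod ((z - cen a w) / a ^ n)"
      using scale_nz by (simp add: norm_divide norm_power divide_simps)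
    then show ?thesis by (simp add: kernel_def)
  qed
  then have "charge a n z = (\<Sum>w\<in>words n. a ^ n / (z - cen a w)) / (4 * a) ^ n"
    by (simp add: charge_def)
  also have "(\<Sum>w\<in>words n. a ^ n / (z - cen a w)) = a ^ n * (\<Sum>w\<in>words n. 1 / (z - cen a w))"
    by (simp add: sum_distrib_left)
  finally show ?thesis using scale_nz by (simp add: power_mult_distrib)
qed

lemma closed_cells: "closed (cells a n)"
  unfolding cells_def by (intro closed_UN) auto

lemma cells_Suc: "cells a (Suc n) \<subseteq> cells a n"
proof
  fix z assume "z \<in> cells a (Suc n)"
  then obtain w t where w: "w \<in> words n" "t \<in> digits" "cmod (z - cen a (w @ [t])) \<le> cmod a ^ Suc n"
    by (auto simp: cells_def words_Suc_end dist_norm norm_minus_commute simp del: power_Suc)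
  have "cmod (cen a (w @ [t]) - cen a w) = cmod a ^ n * (3/5)"
    using wordsD(2)[OF w(1)] norm_digit[OF w(2)] by (simp add: cen_append norm_mult norm_power)
  moreover have "cmod a ^ Suc n \<le> 3/10 * cmod a ^ n" using mult_right_mono[OF a(1), of "cmod a ^ n"] by simp
  ultimately have "cmod (z - cen a w) \<le> cmod a ^ n * (3/5) + 3/10 * cmod a ^ n"
    using w(3) norm_triangle_ineq[of "z - cen a (w @ [t])" "cen a (w @ [t]) - cen a w"] by simp
  also have "\<dots> \<le> cmod a ^ n" by simp
  finally show "z \<in> cells a n"
    using w(1) by (auto simp: cells_def dist_norm norm_minus_commute)
qed

lemma cells_antimono: "m \<le> n \<Longrightarrow> cells a n \<subseteq> cells a m"
  by (rule lift_Suc_antimono_le[of "cells a"]) (use cells_Suc in auto)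

lemma holomorphic_charge:
  assumes "m \<le> n"
  shows "charge a n holomorphic_on - cells a m"
proof -
  have "(\<lambda>z. (\<Sum>w\<in>words n. 1 / (z - cen a w)) / 4 ^ n) holomorphic_on - cells a n"
    by (intro holomorphic_intros) (auto simp: cells_def)
  then have "charge a n holomorphic_on - cells a n"
    by (rule holomorphic_transform) (use charge_off_cells in auto)
  then show ?thesis using cells_antimono[OF assms] by (auto elim!: holomorphic_on_subset)
qed

lemma sphere_off_cells: "z \<in> sphere 0 1 \<Longrightarrow> 0 < n \<Longrightarrow> z \<notin> cells a n"
proof
  assume z: "z \<in> sphere 0 1" "0 < n" "z \<in> cells a n"
  then obtain w where w: "w \<in> words n" "cmod (z - cen a w) \<le> cmod a ^ n"
    by (auto simp: cells_def dist_norm norm_minus_commute)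
  have "w \<noteq> []" using wordsD(2)[OF w(1)] z(2) by auto
  then show False
    using cen_nonempty_bounds(1)[OF a(1) wordsD(1)[OF w(1)]] wordsD(2)[OF w(1)] w(2) z(1)
      norm_triangle_sub[of z "cen a w"] by simp
qed

lemma charge_integral:
  assumes "0 < n"
  shows "(charge a n has_contour_integral 2 * pi * \<i>) (circlepath 0 1)"
proof -
  have "((\<lambda>z. 1 / (z - cen a w)) has_contour_integral 2 * pi * \<i>) (circlepath 0 1)" if "w \<in> words n" for w
  proof -
    have "w \<noteq> []" using wordsD(2)[OF that] assms by auto
    then have "cmod (cen a w) < 1"
      using cen_nonempty_bounds(1)[OF a(1) wordsD(1)[OF that]] zero_le_power[OF norm_ge_zero, of a "length w"]
      by linarith
    then have "cmod (cen a w - 0) < 1" by simp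
    from Cauchy_integral_circlepath_simple[OF _ this, of "\<lambda>_. 1"] show ?thesis by simp
  qed
  then have "((\<lambda>z. (\<Sum>w\<in>words n. 1 / (z - cen a w)) / 4 ^ n) has_contour_integral
      (\<Sum>w\<in>words n. 2 * pi * \<i>) / 4 ^ n) (circlepath 0 1)"
    by (intro has_contour_integral_div has_contour_integral_sum) auto
  then have "((\<lambda>z. (\<Sum>w\<in>words n. 1 / (z - cen a w)) / 4 ^ n) has_contour_integral 2 * pi * \<i>) (circlepath 0 1)"
    by (simp add: card_words)
  then show ?thesis
    by (rule has_contour_integral_eq) (use charge_off_cells sphere_off_cells assms in auto)
qed

lemma charge_limit:
  obtains f where "continuous_on UNIV f" "\<And>m. f holomorphic_on - cells a m"
    "contour_integral (circlepath 0 1) f = 2 * pi * \<i>"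
proof -
  define C where "C = 5 * (1 + 100 / (1 - 4 * cmod a ^ 2))"
  \<comment> \<open>A telescoping series: its partial sums are the charges, and
    \<open>charge_step\<close> provides a summable majorant.\<close>
  define f where "f z = charge a 0 z + (\<Sum>k. charge a (Suc k) z - charge a k z)" for z
  have "summable (\<lambda>n. (1 / (4 * cmod a)) ^ n)"
    using a by (intro summable_geometric) (simp add: divide_simps)
  then have sum: "summable (\<lambda>n. C * (1 / (4 * cmod a)) ^ n)" by (rule summable_mult)
  have "uniform_limit UNIV (\<lambda>n z. \<Sum>k<n. charge a (Suc k) z - charge a k z) (\<lambda>z. \<Sum>k. charge a (Suc k) z - charge a k z) sequentially"
    by (rule Weierstrass_m_test[OF _ sum]) (use charge_step in \<open>simp add: C_def\<close>)
  then have "uniform_limit UNIV (\<lambda>n z. charge a 0 z + (\<Sum>k<n. charge a (Suc k) z - charge a k z)) f sequentially"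
    unfolding f_def by (intro uniform_limit_intros)
  moreover have "charge a 0 z + (\<Sum>k<n. charge a (Suc k) z - charge a k z) = charge a n z" for n z
    by (subst sum_lessThan_telescope) simp
  ultimately have ul: "uniform_limit UNIV (charge a) f sequentially" by simp
  have 1: "continuous_on UNIV f"
    using ul continuous_on_charge by (intro uniform_limit_theorem) auto
  \<comment> \<open>The shift by \<open>m\<close> discards the earlier generations, whose kernels
    involve \<open>cnj\<close> outside \<open>cells a m\<close>.\<close>
  have 2: "f holomorphic_on - cells a m" for m
  proof (rule holomorphic_uniform_sequence[of _ "\<lambda>n. charge a (n + m)"])
    show "charge a (n + m) holomorphic_on - cells a m" for n by (rule holomorphic_charge) auto
    fix x assume "x \<in> - cells a m"
    then obtain d where "0 < d" "cball x d \<subseteq> - cells a m"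
      using open_contains_cball_eq[of "- cells a m"] closed_cells by auto
    moreover have "uniform_limit UNIV (\<lambda>n. charge a (n + m)) f sequentially"
      using ul unfolding uniform_limit_iff eventually_sequentially by (meson trans_le_add1)
    ultimately show "\<exists>d>0. cball x d \<subseteq> - cells a m \<and> uniform_limit (cball x d) (\<lambda>n. charge a (n + m)) f sequentially"
      using uniform_limit_on_subset by blast
  qed (use closed_cells in auto)
  have ev: "eventually (\<lambda>n. charge a n contour_integrable_on circlepath 0 1) sequentially"
    using eventually_gt_at_top[of 0] by eventually_elim (use charge_integral in \<open>auto simp: contour_integrable_on_def\<close>)
  have "(\<lambda>n. contour_integral (circlepath 0 1) (charge a n)) \<longlonglongrightarrow> contour_integral (circlepath 0 1) f"
    by (rule contour_integral_uniform_limit_circlepath(2)[OF ev])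
      (auto intro: uniform_limit_on_subset[OF ul])
  moreover have "eventually (\<lambda>n. contour_integral (circlepath 0 1) (charge a n) = 2 * pi * \<i>) sequentially"
    using eventually_gt_at_top[of 0] by eventually_elim (use charge_integral in \<open>auto intro: contour_integral_unique\<close>)
  then have "(\<lambda>n. contour_integral (circlepath 0 1) (charge a n)) \<longlonglongrightarrow> 2 * pi * \<i>"
    by (rule tendsto_eventually)
  ultimately have 3: "contour_integral (circlepath 0 1) f = 2 * pi * \<i>"
    by (rule LIMSEQ_unique)
  show ?thesis using that[OF 1 2 3] .
qed

text \<open>A hole lies inside its own cell but clear of the next generation, hence the index one
  above the length. A function holomorphic off every \<open>cells a m\<close> is thus holomorphic
  across each hole.\<close>

lemma hole_off_cells:
  assumes "w \<in> lists digits"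
  shows "cball (cen a w) (rad a (length w)) \<inter> cells a (Suc (length w)) = {}"
proof -
  have "cball (cen a w) (rad a (length w)) \<inter> cball (cen a v) (cmod a ^ Suc (length w)) = {}" if v: "v \<in> words (Suc (length w))" for v
  proof -
    have "cmod a ^ length w / 5 + cmod a ^ Suc (length w) < cmod (cen a w - cen a v)"
      by (rule cen_sep_level[OF a(1) scale_nz, of w v, unfolded wordsD(2)[OF v]])
        (use assms wordsD[OF v] in auto)
    moreover have "rad a (length w) \<le> cmod a ^ length w / 5"
      using rad_le[of a "length w"] zero_le_power[OF norm_ge_zero, of a "length w"] by linarith
    ultimately have "rad a (length w) + cmod a ^ Suc (length w) < cmod (cen a w - cen a v)" by linarith
    then show ?thesis
      by (rule disjoint_cball_dist)
  qed
  then show ?thesis by (auto simp: cells_def)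
qed

text \<open>Every cell centre lies in a hole, so a ball of radius \<open>e\<close> inside the cheese
  cannot have its centre in a cell of radius below \<open>e\<close>. Interior points therefore avoid
  the cells of some generation.\<close>

lemma holomorphic_A_alg_cheese:
  assumes "continuous_on UNIV f" "\<And>m. f holomorphic_on - cells a m"
  shows "f \<in> A_alg (cheese a)"
proof -
  have "interior (cheese a) \<subseteq> (\<Union>m. - cells a m)"
  proof
    fix z assume "z \<in> interior (cheese a)"
    then obtain e where e: "0 < e" "ball z e \<subseteq> cheese a" by (auto simp: mem_interior)
    have "(\<lambda>n. cmod a ^ n) \<longlonglongrightarrow> 0" using a by (intro LIMSEQ_power_zero) auto
    then have "eventually (\<lambda>n. cmod a ^ n < e) sequentially"
      using e(1) by (intro order_tendstoD(2)) auto
    then obtain n where n: "cmod a ^ n < e" by (auto simp: eventually_sequentially)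
    have "z \<notin> cells a n"
    proof
      assume "z \<in> cells a n"
      then obtain w where w: "w \<in> words n" "dist (cen a w) z \<le> cmod a ^ n" by (auto simp: cells_def)
      then have "cen a w \<in> cheese a" using e(2) n by (auto simp: dist_commute)
      moreover have "cen a w \<in> ball (cen a w) (rad a (length w))" using rad_pos[OF scale_nz] by simp
      ultimately show False using wordsD(1)[OF w(1)] unfolding cheese_def by blast
    qed
    then show "z \<in> (\<Union>m. - cells a m)" by blast
  qed
  moreover have "f holomorphic_on (\<Union>m. - cells a m)"
    using assms(2) closed_cells by (intro holomorphic_on_UN_open) auto
  ultimately show ?thesis
    using assms(1) unfolding A_alg_def by (auto intro: continuous_on_subset holomorphic_on_subset)
qed

section \<open>Holes, residues and the contradiction\<close>

lemma sum_rad_le: "(\<Sum>w\<in>words_upto n. rad a (length w)) \<le> 1"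
proof -
  have "(\<Sum>w\<in>words_upto n. rad a (length w)) = (\<Sum>m\<le>n. \<Sum>w\<in>words m. rad a (length w))"
    unfolding words_upto_def by (rule sum.UNION_disjoint) (auto dest: wordsD(2))
  also have "\<dots> = (\<Sum>m\<le>n. (cmod a / 2) ^ m / 20)"
  proof (rule sum.cong)
    fix m
    have "(\<Sum>w\<in>words m. rad a (length w)) = (\<Sum>w\<in>words m. rad a m)"
      by (rule sum.cong) (auto simp: wordsD)
    also have "\<dots> = 4 ^ m * (cmod a / 8) ^ m / 20" by (simp add: card_words rad_def)
    also have "\<dots> = (4 * (cmod a / 8)) ^ m / 20" by (simp only: power_mult_distrib)
    finally show "(\<Sum>w\<in>words m. rad a (length w)) = (cmod a / 2) ^ m / 20" by simp
  qed simp
  also have "\<dots> \<le> (\<Sum>m\<le>n. (1/2) ^ m / 20)"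
    using a by (intro sum_mono divide_right_mono power_mono) auto
  also have "\<dots> = (\<Sum>m\<le>n. (1/2) ^ m) / 20" by (simp add: sum_divide_distrib)
  also have "(\<Sum>m\<le>n. (1/2) ^ m) \<le> (\<Sum>m. (1/2 :: real) ^ m)"
    by (rule sum_le_suminf) auto
  also have "\<dots> = 2" by (subst suminf_geometric) auto
  finally show ?thesis by simp
qed

lemma hole_integral_zero:
  assumes "\<And>m. f holomorphic_on - cells a m" "w \<in> lists digits"
  shows "(f has_contour_integral 0) (circlepath (cen a w) (rad a (length w)))"
  by (rule contour_integral_circlepath_zero[OF assms(1)[of "Suc (length w)"]])
    (use hole_off_cells[OF assms(2)] rad_pos[OF scale_nz] in \<open>auto intro: less_imp_le\<close>)

lemma cball_hole_disjoint:
  assumes "v \<in> lists digits" "w \<in> lists digits" "v \<noteq> w"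
  shows "cball (cen a v) (rad a (length v)) \<inter> cball (cen a w) (rad a (length w)) = {}"
  by (rule disjoint_cball_dist) (rule rad_disjoint[OF a(1) scale_nz assms])

lemma hole_boundary_subset:
  assumes "w \<in> lists digits"
  shows "sphere (cen a w) (rad a (length w)) \<subseteq> cheese a"
proof
  fix z assume z: "z \<in> sphere (cen a w) (rad a (length w))"
  have "z \<notin> ball (cen a v) (rad a (length v))" if "v \<in> lists digits" for v
  proof (cases "v = w")
    case False
    have "z \<in> cball (cen a w) (rad a (length w))" using z by simp
    then show ?thesis
      using cball_hole_disjoint[OF that assms False] ball_subset_cball[of "cen a v" "rad a (length v)"] by blast
  qed (use z in auto)
  moreover have "rad a (length w) \<le> cmod a ^ length w"
    using rad_le[of a "length w"] zero_le_power[OF norm_ge_zero, of a "length w"] by linarith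
  then have "cmod z \<le> 1"
    using z cen_bound[OF a(1) assms] norm_triangle_sub[of z "cen a w"]
    by (simp add: dist_norm norm_minus_commute)
  ultimately show "z \<in> cheese a" by (auto simp: cheese_def)
qed

lemma unit_circle_subset: "sphere 0 1 \<subseteq> cheese a"
proof
  fix z :: complex assume z: "z \<in> sphere 0 1"
  have "z \<notin> ball (cen a w) (rad a (length w))" if w: "w \<in> lists digits" for w
  proof -
    have "cmod (cen a w) + rad a (length w) < 1"
    proof (cases "w = []")
      case False
      then show ?thesis
        using cen_nonempty_bounds(1)[OF a(1) w] rad_le[of a "length w"] zero_le_power[OF norm_ge_zero, of a "length w"]
        by linarith
    qed (simp add: rad_def)
    then show ?thesis
      using z norm_triangle_sub[of z "cen a w"] by (simp add: dist_norm norm_minus_commute)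
  qed
  then show "z \<in> cheese a" using z by (auto simp: cheese_def)
qed

text \<open>The winding number of the circle is 1 about the poles inside and 0 about those outside.
  This form lets the integral over the unit circle be compared with those over the holes.\<close>

lemma rational_residues:
  assumes "q \<noteq> 0" "\<And>z. z \<in> sphere c r \<Longrightarrow> poly q z \<noteq> 0" "0 < r"
  shows "((\<lambda>z. poly p z / poly q z) has_contour_integral
    2 * pi * \<i> * (\<Sum>x\<in>{x. poly q x = 0} \<inter> ball c r. residue (\<lambda>z. poly p z / poly q z) x)) (circlepath c r)"
proof -
  define g where "g z = poly p z / poly q z" for z
  define Z where "Z = {x. poly q x = 0}"
  have finZ: "finite Z" unfolding Z_def using assms(1) by (rule poly_roots_finite)
  have hol: "g holomorphic_on - Z"
    unfolding g_def Z_def by (intro holomorphic_on_divide) (auto intro: poly_holomorphic)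
  have img: "path_image (circlepath c r) \<subseteq> - Z" using assms(2,3) by (auto simp: Z_def)
  have "contour_integral (circlepath c r) g = 2 * pi * \<i> * (\<Sum>x\<in>Z. winding_number (circlepath c r) x * residue g x)"
    by (rule Residue_theorem[of UNIV]) (use finZ hol img in \<open>auto simp: Compl_eq_Diff_UNIV\<close>)
  also have "(\<Sum>x\<in>Z. winding_number (circlepath c r) x * residue g x)
      = (\<Sum>x\<in>Z. if x \<in> ball c r then residue g x else 0)"
  proof (rule sum.cong)
    fix x assume "x \<in> Z"
    then have "x \<notin> sphere c r" using assms(2) by (auto simp: Z_def)
    then consider "x \<in> ball c r" | "x \<notin> cball c r" by fastforce
    then show "winding_number (circlepath c r) x * residue g x = (if x \<in> ball c r then residue g x else 0)"
    proof cases
      case 1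
      then show ?thesis using winding_number_circlepath[of x c r] by (simp add: dist_norm norm_minus_commute)
    next
      case 2
      have "winding_number (circlepath c r) x = 0"
        by (rule winding_number_zero_outside[of _ "cball c r"]) (use 2 assms(3) in auto)
      then show ?thesis using 2 by auto
    qed
  qed simp
  also have "\<dots> = (\<Sum>x\<in>Z \<inter> ball c r. residue g x)"
    using finZ by (simp add: sum.inter_restrict)
  finally have "contour_integral (circlepath c r) g = 2 * pi * \<i> * (\<Sum>x\<in>Z \<inter> ball c r. residue g x)" .
  moreover have "g contour_integrable_on circlepath c r"
    by (rule contour_integrable_holomorphic_simple[OF hol]) (use finZ img in \<open>auto simp: finite_imp_closed\<close>)
  ultimately show ?thesis
    using has_contour_integral_integral unfolding g_def[abs_def] Z_def by metis
qed

text \<open>Let \<open>g\<close> be rational and within 1/4 of \<open>f\<close> on the cheese. As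
  \<open>f\<close> integrates to 0 around a hole, \<open>g\<close> integrates to at most pi/2 times
  its radius there. The radii sum to at most 1, so over the unit circle \<open>g\<close> gives at
  most pi/2, while the integral of \<open>f\<close> is 2 pi i and differs by at most pi/2.\<close>

theorem R_alg_cheese_neq_A_alg: "R_alg (cheese a) \<noteq> A_alg (cheese a)"
proof
  assume eq: "R_alg (cheese a) = A_alg (cheese a)"
  obtain f where f: "continuous_on UNIV f" "\<And>m. f holomorphic_on - cells a m"
    "contour_integral (circlepath 0 1) f = 2 * pi * \<i>"
    using charge_limit by blast
  have "f \<in> R_alg (cheese a)" using holomorphic_A_alg_cheese[OF f(1,2)] eq by simp
  then obtain r where r: "rational_without_poles_on (cheese a) r" "\<And>z. z \<in> cheese a \<Longrightarrow> cmod (f z - r z) < 1/4"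
    unfolding R_alg_iff by (meson zero_less_divide_1_iff zero_less_numeral)
  then obtain p q where q: "q \<noteq> 0" "\<And>z. z \<in> cheese a \<Longrightarrow> poly q z \<noteq> 0"
    "\<And>z. z \<in> cheese a \<Longrightarrow> r z = poly p z / poly q z"
    unfolding rational_without_poles_on_def by blast
  define g where "g z = poly p z / poly q z" for z
  define Z where "Z = {x. poly q x = 0}"
  have finZ: "finite Z" unfolding Z_def using q(1) by (rule poly_roots_finite)
  have near: "cmod (f z - g z) \<le> 1/4" if "z \<in> cheese a" for z
    using r(2)[OF that] q(3)[OF that] by (simp add: g_def)
  have intg: "(g has_contour_integral 2 * pi * \<i> * (\<Sum>x\<in>Z \<inter> ball c s. residue g x)) (circlepath c s)"
    if "sphere c s \<subseteq> cheese a" "0 < s" for c s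
    unfolding g_def[abs_def] Z_def by (rule rational_residues) (use q that in auto)
  have diff: "cmod (contour_integral (circlepath c s) f - 2 * pi * \<i> * (\<Sum>x\<in>Z \<inter> ball c s. residue g x)) \<le> 1/4 * (2 * pi * s)"
    if "sphere c s \<subseteq> cheese a" "0 < s" for c s
  proof (rule has_contour_integral_bound_circlepath)
    have "(f has_contour_integral contour_integral (circlepath c s) f) (circlepath c s)"
      using f(1) that(2) by (intro has_contour_integral_integral contour_integrable_continuous_circlepath) (auto elim: continuous_on_subset)
    from has_contour_integral_diff[OF this intg[OF that]]
    show "((\<lambda>z. f z - g z) has_contour_integral contour_integral (circlepath c s) f - 2 * pi * \<i> * (\<Sum>x\<in>Z \<inter> ball c s. residue g x)) (circlepath c s)" .
    show "cmod (f x - g x) \<le> 1/4" if "cmod (x - c) = s" for x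
      using near[of x] \<open>sphere c s \<subseteq> cheese a\<close> that by (auto simp: dist_norm norm_minus_commute)
  qed (use that in auto)
  have hole: "cmod (2 * pi * \<i> * (\<Sum>x\<in>Z \<inter> ball (cen a w) (rad a (length w)). residue g x)) \<le> 1/4 * (2 * pi * rad a (length w))"
    if "w \<in> lists digits" for w
    using diff[OF hole_boundary_subset[OF that] rad_pos[OF scale_nz]]
      contour_integral_unique[OF hole_integral_zero[OF f(2) that]] by simp
  \<comment> \<open>A pole in the unit disc is not in the cheese, so some hole contains it.\<close>
  have cover: "\<exists>w\<in>lists digits. x \<in> ball (cen a w) (rad a (length w))" if "x \<in> Z \<inter> ball 0 1" for x
  proof -
    have "x \<notin> cheese a" "x \<in> cball 0 1" using that q(2) by (auto simp: Z_def)
    then show ?thesis unfolding cheese_def by blast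
  qed
  then obtain W where W: "\<And>x. x \<in> Z \<inter> ball 0 1 \<Longrightarrow> W x \<in> lists digits \<and> x \<in> ball (cen a (W x)) (rad a (length (W x)))"
    by metis
  \<comment> \<open>The poles are finite in number, so holes of bounded generation contain them all
    and only finite sums occur.\<close>
  define N where "N = Max (insert 0 ((length \<circ> W) ` (Z \<inter> ball 0 1)))"
  have N: "W x \<in> words_upto N" if "x \<in> Z \<inter> ball 0 1" for x
    using W[OF that] finZ that by (auto simp: words_upto_iff N_def intro!: Max_ge)
  have inball: "ball (cen a w) (rad a (length w)) \<subseteq> ball 0 1" if w: "w \<in> lists digits" for w
  proof -
    have "cball (cen a w) (rad a (length w)) \<subseteq> ball 0 1"
      using outer_in_disc[OF a(1) scale_nz, of "Suc (length w)" w] inner_outer(2)[OF a(1) scale_nz, of "Suc (length w)" w] w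
      by (auto simp: words_upto_iff inner_rad_def subset_iff)
    then show ?thesis using ball_subset_cball by blast
  qed
  have "Z \<inter> ball 0 1 = (\<Union>w\<in>words_upto N. Z \<inter> ball (cen a w) (rad a (length w)))"
  proof (intro equalityI subsetI)
    fix x assume x: "x \<in> Z \<inter> ball 0 1"
    then show "x \<in> (\<Union>w\<in>words_upto N. Z \<inter> ball (cen a w) (rad a (length w)))"
      using N[OF x] W[OF x] by blast
  next
    fix x assume "x \<in> (\<Union>w\<in>words_upto N. Z \<inter> ball (cen a w) (rad a (length w)))"
    then obtain w where w: "w \<in> words_upto N" and x: "x \<in> Z \<inter> ball (cen a w) (rad a (length w))"
      by (rule UN_E)
    have "ball (cen a w) (rad a (length w)) \<subseteq> ball 0 1"
      using w by (intro inball) (simp add: words_upto_iff)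
    then show "x \<in> Z \<inter> ball 0 1" using x by (rule subsetD[OF Int_mono[OF subset_refl]])
  qed
  then have "(\<Sum>x\<in>Z \<inter> ball 0 1. residue g x) = (\<Sum>w\<in>words_upto N. \<Sum>x\<in>Z \<inter> ball (cen a w) (rad a (length w)). residue g x)"
  proof (subst sum.UNION_disjoint[symmetric])
    show "\<forall>v\<in>words_upto N. \<forall>w\<in>words_upto N. v \<noteq> w \<longrightarrow>
        (Z \<inter> ball (cen a v) (rad a (length v))) \<inter> (Z \<inter> ball (cen a w) (rad a (length w))) = {}"
    proof (intro ballI impI)
      fix v w assume "v \<in> words_upto N" "w \<in> words_upto N" "v \<noteq> w"
      then show "(Z \<inter> ball (cen a v) (rad a (length v))) \<inter> (Z \<inter> ball (cen a w) (rad a (length w))) = {}"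
        using cball_hole_disjoint[of v w] ball_subset_cball[of "cen a v" "rad a (length v)"]
          ball_subset_cball[of "cen a w" "rad a (length w)"] unfolding words_upto_iff by blast
    qed
  qed (use finZ in auto)
  then have "cmod (2 * pi * \<i> * (\<Sum>x\<in>Z \<inter> ball 0 1. residue g x))
      = cmod (\<Sum>w\<in>words_upto N. 2 * pi * \<i> * (\<Sum>x\<in>Z \<inter> ball (cen a w) (rad a (length w)). residue g x))"
    by (simp add: sum_distrib_left)
  also have "\<dots> \<le> (\<Sum>w\<in>words_upto N. 1/4 * (2 * pi * rad a (length w)))"
    by (rule sum_norm_le) (use hole in \<open>auto simp: words_upto_iff\<close>)
  also have "\<dots> = 1/4 * (2 * pi) * (\<Sum>w\<in>words_upto N. rad a (length w))"
    by (simp add: sum_distrib_left mult.assoc)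
  also have "\<dots> \<le> 1/4 * (2 * pi) * 1"
    using sum_rad_le by (intro mult_left_mono) auto
  finally have small: "cmod (2 * pi * \<i> * (\<Sum>x\<in>Z \<inter> ball 0 1. residue g x)) \<le> pi / 2" by simp
  have "cmod (2 * pi * \<i> - 2 * pi * \<i> * (\<Sum>x\<in>Z \<inter> ball 0 1. residue g x)) \<le> pi / 2"
    using diff[OF unit_circle_subset] f(3) by simp
  then have "cmod (2 * pi * \<i>) \<le> pi / 2 + pi / 2"
    using small norm_triangle_sub[of "2 * pi * \<i>" "2 * pi * \<i> * (\<Sum>x\<in>Z \<inter> ball 0 1. residue g x)"] by linarith
  then show False using pi_gt_zero by (simp add: norm_mult)
qed

end

section \<open>The counterexample\<close>

theorem theorem1p2:
  shows "\<exists>(K :: complex set) (H :: complex \<Rightarrow> complex \<Rightarrow> complex) (w :: complex).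
           compact K \<and> holomorphic_motion K H \<and> w \<in> ball 0 1 \<and>
           R_alg K = A_alg K \<and> R_alg (H w ` K) \<noteq> A_alg (H w ` K)"
proof (intro exI conjI)
  show "compact (cheese (6/25))" by (rule compact_cheese)
  show "holomorphic_motion (cheese (6/25)) motion" by (rule holomorphic_motion_motion)
  \<comment> \<open>The starting ratio 6/25 is below 1/4, and this parameter gives 6/25 * (1 + 1/20)
    = 63/250, which is above 1/4 and still at most 3/10.\<close>
  show "4/5 \<in> ball (0 :: complex) 1" by simp
  show "R_alg (cheese (6/25)) = A_alg (cheese (6/25))" by (rule R_alg_cheese_eq_A_alg) auto
  have "motion (4/5) ` cheese (6/25) = cheese (ratio (4/5))" by (rule motion_cheese) simp
  moreover have "ratio (4/5) = 63/250" by (simp add: ratio_def)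
  moreover have "R_alg (cheese (63/250)) \<noteq> A_alg (cheese (63/250))"
    by (rule R_alg_cheese_neq_A_alg) auto
  ultimately show "R_alg (motion (4/5) ` cheese (6/25)) \<noteq> A_alg (motion (4/5) ` cheese (6/25))"
    by simp
qed

end
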